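(* Let $x\in D_1$, $\nu\in\mathbb{C}$, $\mu\in\mathbb{C}\setminus\mathbb{Z}$ with $\nu+\mu\notin-\mathbb{N}$. Then $$\mathsf{Q}_\nu^\mu(x)=\frac{\pi}{2\sin(\pi\mu)}\Bigg[\frac{\cos(\pi\mu)}{\Gamma(1-\mu)}\left(\frac{1+x}{1-x}\right)^{\frac12\mu}{}_2F_1\!\left(-\nu,\nu+1;1-\mu;\frac{1-x}{2}\right)-\frac{\Gamma(\nu+\mu+1)}{\Gamma(\mu+1)\Gamma(\nu-\mu+1)}\left(\frac{1-x}{1+x}\right)^{\frac12\mu}{}_2F_1\!\left(-\nu,\nu+1;1+\mu;\frac{1-x}{2}\right)\Bigg].$$
   Context: $\mathbb{N}=\{1,2,3,\dots\}$, $-\mathbb{N}=\{-1,-2,\dots\}$. $D_1=\mathbb{C}\setminus((-\infty,-1]\cup[1,\infty))$, $D_2=\mathbb{C}\setminus(-\infty,1]$. Complex powers are principal values. ${}_2F_1(a,b;c;w)$ is the Gauss hypergeometric function, principal branch on $\mathbb{C}\setminus[1,\infty)$ (the analytic continuation of $\sum_{n\ge0}\frac{(a)_n(b)_n}{(c)_n}\frac{w^n}{n!}$). $1/\Gamma$ is read as the entire function (zero at the poles of $\Gamma$), and a quotient ${}_2F_1(a,b;c;w)/\Gamma(c)$ with $c\in\{0,-1,-2,\dots\}$ is read as the regularized function (continuous in $c$). Associated Legendre function of the second kind: for $z\in D_2$, $\nu+\mu\in\mathbb{C}\setminus-\mathbb{N}$, $$Q_\nu^\mu(z)=\frac{\sqrt{\pi}\,e^{i\pi\mu}\Gamma(\nu+\mu+1)(z^2-1)^{\frac12\mu}}{2^{\nu+1}\Gamma(\nu+\frac32)z^{\nu+\mu+1}}\,{}_2F_1\!\left(\tfrac{\nu+\mu+2}{2},\tfrac{\nu+\mu+1}{2};\nu+\tfrac32;\tfrac1{z^2}\right),$$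 where $(z^2-1)^\alpha:=(z+1)^\alpha(z-1)^\alpha$. Ferrers function of the second kind: for $x\in(-1,1)$, $$\mathsf{Q}_\nu^\mu(x)=\tfrac12\big[e^{-\frac12 i\pi\mu}\,e^{-i\pi\mu}Q_\nu^\mu(x+i0)+e^{\frac12 i\pi\mu}\,e^{-i\pi\mu}Q_\nu^\mu(x-i0)\big],$$ where $x\pm i0$ denotes the limit from the upper/lower half-plane, and $\mathsf{Q}_\nu^\mu$ is extended analytically to $D_1$. *)

theory Defs
  imports "HOL-Complex_Analysis.Complex_Analysis"
begin

definition ferrers_domain :: "complex set" where
  "ferrers_domain = - complex_of_real ` ({..-1} \<union> {1..})"

text \<open>
  The analytic continuation of the germ at 0 given by \<open>F\<close> to the plane cut along
  \<open>[1, \<infinity>)\<close>. The cut plane is connected, so the values there are uniquely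
  determined if a continuation exists; values on the cut are irrelevant.
\<close>
definition cut_plane_continuation :: "complex fps \<Rightarrow> complex \<Rightarrow> complex" where
  "cut_plane_continuation F =
     (SOME f. f holomorphic_on (- complex_of_real ` {1..}) \<and> f has_fps_expansion F)"

definition hyp2F1 :: "complex \<Rightarrow> complex \<Rightarrow> complex \<Rightarrow> complex \<Rightarrow> complex" where
  "hyp2F1 a b c = cut_plane_continuation (fps_hypergeo [a, b] [c] 1)"

text \<open>
  The regularized function, i.e. the quotient of \<open>hyp2F1 a b c w\<close> by \<open>Gamma c\<close>, which
  makes sense for every \<open>c\<close>, including the nonpositive integers. Its Taylor coefficients
  are \<open>(a)\<^sub>n (b)\<^sub>n / (\<Gamma>(c + n) n!)\<close>, entire in \<open>c\<close>.
\<close>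
definition hyp2F1_reg_fps :: "complex \<Rightarrow> complex \<Rightarrow> complex \<Rightarrow> complex fps" where
  "hyp2F1_reg_fps a b c =
     Abs_fps (\<lambda>n. pochhammer a n * pochhammer b n * rGamma (c + of_nat n) / fact n)"

definition hyp2F1_reg :: "complex \<Rightarrow> complex \<Rightarrow> complex \<Rightarrow> complex \<Rightarrow> complex" where
  "hyp2F1_reg a b c = cut_plane_continuation (hyp2F1_reg_fps a b c)"

lemma hyp2F1_reg_fps_conv_hypergeo:
  assumes "c \<notin> \<int>\<^sub>\<le>\<^sub>0"
  shows "hyp2F1_reg_fps a b c = fps_const (rGamma c) * fps_hypergeo [a, b] [c] 1"
proof (rule fps_ext)
  fix n
  have "pochhammer c n \<noteq> 0"
    using assms by (auto simp: pochhammer_eq_0_iff)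
  thus "hyp2F1_reg_fps a b c $ n = (fps_const (rGamma c) * fps_hypergeo [a, b] [c] 1) $ n"
    by (simp add: hyp2F1_reg_fps_def pochhammer_rGamma[of c n] field_simps)
qed

text \<open>
  Intended for \<open>z\<close> off the cut \<open>(-\<infinity>, 1]\<close> and \<open>\<nu> + \<mu>\<close> not a negative integer. The factor
  \<open>1 / \<Gamma>(\<nu> + 3/2)\<close> is absorbed into the regularized hypergeometric function, and
  \<open>(z\<^sup>2 - 1)\<^sup>\<alpha>\<close> is read as \<open>(z + 1)\<^sup>\<alpha> (z - 1)\<^sup>\<alpha>\<close>.
\<close>
definition legendre_Q :: "complex \<Rightarrow> complex \<Rightarrow> complex \<Rightarrow> complex" where
  "legendre_Q \<nu> \<mu> z =
     of_real (sqrt pi) * exp (\<i> * of_real pi * \<mu>) * Gamma (\<nu> + \<mu> + 1) *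
       ((z + 1) powr (\<mu> / 2) * (z - 1) powr (\<mu> / 2)) /
       (2 powr (\<nu> + 1) * z powr (\<nu> + \<mu> + 1)) *
     hyp2F1_reg ((\<nu> + \<mu> + 2) / 2) ((\<nu> + \<mu> + 1) / 2) (\<nu> + 3 / 2) (1 / z\<^sup>2)"

definition legendre_Q_above :: "complex \<Rightarrow> complex \<Rightarrow> real \<Rightarrow> complex" where
  "legendre_Q_above \<nu> \<mu> x = Lim (at (of_real x) within {z. Im z > 0}) (legendre_Q \<nu> \<mu>)"

definition legendre_Q_below :: "complex \<Rightarrow> complex \<Rightarrow> real \<Rightarrow> complex" where
  "legendre_Q_below \<nu> \<mu> x = Lim (at (of_real x) within {z. Im z < 0}) (legendre_Q \<nu> \<mu>)"

definition ferrers_Q_real :: "complex \<Rightarrow> complex \<Rightarrow> real \<Rightarrow> complex" where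
  "ferrers_Q_real \<nu> \<mu> x =
     1 / 2 * (exp (- (\<i> * of_real pi * \<mu> / 2)) * exp (- (\<i> * of_real pi * \<mu>)) *
                legendre_Q_above \<nu> \<mu> x +
              exp (\<i> * of_real pi * \<mu> / 2) * exp (- (\<i> * of_real pi * \<mu>)) *
                legendre_Q_below \<nu> \<mu> x)"

text \<open>
  The analytic extension from \<open>(-1, 1)\<close>; unique on the connected set \<open>ferrers_domain\<close>
  by the identity theorem, irrelevant elsewhere.
\<close>
definition ferrers_Q :: "complex \<Rightarrow> complex \<Rightarrow> complex \<Rightarrow> complex" where
  "ferrers_Q \<nu> \<mu> =
     (SOME f. f holomorphic_on ferrers_domain \<and>
        (\<forall>x\<in>{-1<..<1}. f (of_real x) = ferrers_Q_real \<nu> \<mu> x))"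

end

theory Submission
  imports Defs "HOL-Real_Asymp.Real_Asymp"
begin

text \<open>
  With w = 4 s / (1 + s)^2 the hypergeometric equation becomes an equation in s without
  singularities in the punctured unit disc, so that the regularized hypergeometric series continues
  to the whole cut plane. The functions P and Q, divided by suitable Gamma factors, obey the same
  lowering and raising relations in the degree; therefore the Casoratian of any two of them does
  not depend on z. The Casoratian of P with orders \<mu> and -\<mu> is read off at z = 1, that of Q and P at
  infinity, where the behaviour of P follows from the Pfaff transformation and Gauss's summation
  theorem once the real part of \<nu> is large. This gives the connection formula expressing Q by P for
  large \<nu>; the lowering operator carries it to all \<nu>. Its boundary values on (-1, 1) combine
  to the claimed formula, and the identity theorem extends it to the doubly slit plane.
\<close>

section \<open>Analytic continuation of the hypergeometric series\<close>

text \<open>The hypergeometric functions and the extended Ferrers function are given by choice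
  operators, so nothing can be said about them until a suitable function has been exhibited. This
  forces the continuation of the series beyond its disc. The regularized function is the working
  object: in Q the lower parameter \<nu> + 3/2 may be a nonpositive integer, and the contiguous
  relations for it hold for every value of that parameter. Two facts force \<nu> to be large at
  first. Gauss's series for P at infinity converges only if Re (c - a - b) = 1 + 2 Re \<nu> is
  positive, and the product 1 / (Gamma (\<nu> + \<mu> + 1) Gamma (\<nu> - \<mu> + 1)) that all
  Casoratians share has to be cancelled. Removing the restriction by continuation in \<nu> would
  require holomorphy in the parameters; since every \<nu> differs by a natural number from a large
  one, a descending induction in unit steps achieves the same with derivatives in z alone.\<close>

lemma hyp2F1_reg_fps_Suc:
  "of_nat (Suc n) * (c + of_nat n) * hyp2F1_reg_fps a b c $ Suc n =
     (a + of_nat n) * (b + of_nat n) * hyp2F1_reg_fps a b c $ n"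
proof -
  have "rGamma (c + of_nat n) = (c + of_nat n) * rGamma (c + of_nat (Suc n))"
    using rGamma_plus1[of "c + of_nat n"] by (simp add: algebra_simps)
  thus ?thesis
    by (simp add: hyp2F1_reg_fps_def pochhammer_Suc divide_simps del: of_nat_Suc)
qed

text \<open>The hypergeometric equation as a first-order system for \<open>F\<close> and its Euler
  derivative \<open>G\<close>. In this shape a change of variable needs only the chain rule for
  first derivatives; it is used so for the Koebe map and for the Pfaff transformation.\<close>

lemma hyp2F1_reg_fps_ode:
  fixes a b c :: complex
  defines "F \<equiv> hyp2F1_reg_fps a b c"
  defines "G \<equiv> fps_X * fps_deriv F"
  shows "(1 - fps_X) * fps_X * fps_deriv G =
           fps_const (1 - c) * G + fps_X * (fps_const (a + b) * G + fps_const (a * b) * F)"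
proof (rule fps_ext)
  fix n
  show "((1 - fps_X) * fps_X * fps_deriv G) $ n =
    (fps_const (1 - c) * G + fps_X * (fps_const (a + b) * G + fps_const (a * b) * F)) $ n"
  proof (cases n)
    case 0
    thus ?thesis by (simp add: G_def)
  next
    case (Suc m)
    have G: "G $ k = of_nat k * F $ k" for k
      unfolding G_def by (cases k) auto
    have "of_nat (Suc m) * (c + of_nat m) * F $ Suc m = (a + of_nat m) * (b + of_nat m) * F $ m"
      unfolding F_def by (rule hyp2F1_reg_fps_Suc)
    moreover have "((1 - fps_X) * fps_X * fps_deriv G) $ Suc m =
        of_nat (Suc m) * G $ Suc m - of_nat m * G $ m"
      by (cases m) (simp_all add: left_diff_distrib mult.assoc del: of_nat_Suc)
    moreover have "(fps_const (1 - c) * G +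
          fps_X * (fps_const (a + b) * G + fps_const (a * b) * F)) $ Suc m =
        (1 - c) * G $ Suc m + (a + b) * G $ m + a * b * F $ m"
      by simp
    ultimately show ?thesis
      unfolding Suc G by (simp only: of_nat_Suc) algebra
  qed
qed

text \<open>
  A linear recurrence whose characteristic roots all have modulus at most 1 has solutions of
  subexponential growth.
\<close>
lemma conv_radius_ge_1I:
  fixes f g :: "nat \<Rightarrow> complex"
  assumes step: "\<And>n B. n \<ge> N \<Longrightarrow> (\<And>k. k < n \<Longrightarrow> norm (f k) \<le> B \<and> norm (g k) \<le> B) \<Longrightarrow>
      norm (f n) \<le> (1 + C / real n) * B \<and> norm (g n) \<le> (1 + C / real n) * B"
  shows "conv_radius f \<ge> 1"
proof (rule conv_radius_geI_ex')
  fix r :: real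
  assume r: "0 < r" "ereal r < 1"
  \<comment> \<open>Room between \<open>r\<close> and 1: the step factor 1 + C/n is eventually below
    1/\<open>q\<close>, so the coefficients grow at most like (1/\<open>q\<close>)^n, and a
    geometric series of ratio \<open>r\<close>/\<open>q\<close> dominates.\<close>
  obtain q where q: "r < q" "q < 1"
    using r dense[of r 1] by auto
  have "(\<lambda>n. 1 + C / real n) \<longlonglongrightarrow> 1 + 0"
    by (intro tendsto_intros tendsto_divide_0[OF tendsto_const] filterlim_real_sequentially
        filterlim_at_top_imp_at_infinity)
  moreover have "1 + 0 < 1 / q" using q r by simp
  ultimately have "eventually (\<lambda>n. 1 + C / real n < 1 / q) sequentially"
    by (rule order_tendstoD)
  then obtain N' where N': "\<And>n. n \<ge> N' \<Longrightarrow> 1 + C / real n < 1 / q"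
    unfolding eventually_sequentially by blast
  define M where "M = max N N'"
  define K where "K = (\<Sum>k\<le>M. norm (f k) + norm (g k))"
  have K0: "K \<ge> 0" unfolding K_def by (intro sum_nonneg) auto
  have bound: "norm (f n) \<le> K * (1 / q) ^ n \<and> norm (g n) \<le> K * (1 / q) ^ n" for n
  proof (induction n rule: less_induct)
    case (less n)
    show ?case
    proof (cases "n \<le> M")
      case True
      hence "norm (f n) + norm (g n) \<le> K"
        unfolding K_def by (intro member_le_sum) auto
      hence *: "norm (f n) \<le> K" "norm (g n) \<le> K"
        using norm_ge_zero[of "f n"] norm_ge_zero[of "g n"] by linarith+
      have "K * 1 \<le> K * (1 / q) ^ n"
        using q r K0 by (intro mult_left_mono one_le_power) auto
      thus ?thesis using * by linarith
    next
      case False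
      then obtain m where m: "n = Suc m" by (cases n) auto
      have "norm (f k) \<le> K * (1 / q) ^ m \<and> norm (g k) \<le> K * (1 / q) ^ m" if "k < n" for k
      proof -
        have "K * (1 / q) ^ k \<le> K * (1 / q) ^ m"
          using that m q r K0 by (intro mult_left_mono power_increasing) auto
        thus ?thesis using less.IH[OF that] by linarith
      qed
      from step[OF _ this] False have
        *: "norm (f n) \<le> (1 + C / real n) * (K * (1 / q) ^ m)"
           "norm (g n) \<le> (1 + C / real n) * (K * (1 / q) ^ m)"
        by (auto simp: M_def)
      have "(1 + C / real n) * (K * (1 / q) ^ m) \<le> 1 / q * (K * (1 / q) ^ m)"
        using N'[of n] False K0 q r
        by (intro mult_right_mono mult_nonneg_nonneg less_imp_le[of _ "1 / q"]) (auto simp: M_def)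
      also have "\<dots> = K * (1 / q) ^ n" by (simp add: m)
      finally show ?thesis using * by linarith
    qed
  qed
  show "summable (\<lambda>n. f n * of_real r ^ n)"
  proof (rule summable_comparison_test)
    show "\<exists>N. \<forall>n\<ge>N. norm (f n * of_real r ^ n) \<le> K * (r / q) ^ n"
    proof (intro exI allI impI)
      fix n
      have "norm (f n * of_real r ^ n) \<le> K * (1 / q) ^ n * r ^ n"
        using bound[of n] r by (auto simp: norm_mult norm_power intro!: mult_right_mono)
      thus "norm (f n * of_real r ^ n) \<le> K * (r / q) ^ n"
        by (simp add: power_divide)
    qed
    show "summable (\<lambda>n. K * (r / q) ^ n)"
      using q r by (intro summable_mult summable_geometric) auto
  qed
qed

text \<open>The series of -4 k(-s), where k(s) = s / (1 - s)^2 is the Koebe function. As k maps the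
  unit disc onto the plane without the ray from -1/4 to minus infinity, sign and factor are chosen
  to move that ray to the one from 1 to infinity.\<close>

definition koebe_fps :: "complex fps" where
  "koebe_fps = 4 * fps_X * inverse ((1 + fps_X)\<^sup>2)"

lemma koebe_fps_nth_0 [simp]: "koebe_fps $ 0 = 0"
  by (simp add: koebe_fps_def)

lemma koebe_fps_mult: "(1 + fps_X)\<^sup>2 * koebe_fps = 4 * fps_X"
proof -
  have "inverse ((1 + fps_X)\<^sup>2) * ((1 + fps_X :: complex fps)\<^sup>2) = 1"
    by (rule inverse_mult_eq_1) (simp add: power2_eq_square)
  thus ?thesis unfolding koebe_fps_def by (metis mult.commute mult.assoc mult.right_neutral)
qed

text \<open>The logarithmic derivative s w'/w equals (1 - s) / (1 + s). This factor converts the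
  Euler derivative in w into the one in s.\<close>

lemma koebe_fps_deriv: "(1 + fps_X) * (fps_X * fps_deriv koebe_fps) = (1 - fps_X) * koebe_fps"
proof -
  have "fps_deriv ((1 + fps_X)\<^sup>2 * koebe_fps) = fps_deriv (4 * fps_X :: complex fps)"
    by (simp only: koebe_fps_mult)
  hence "2 * (1 + fps_X) * koebe_fps + (1 + fps_X)\<^sup>2 * fps_deriv koebe_fps = 4"
    by (simp add: fps_deriv_power algebra_simps flip: numeral_fps_const)
  hence "fps_X * (2 * (1 + fps_X) * koebe_fps + (1 + fps_X)\<^sup>2 * fps_deriv koebe_fps) =
           (1 + fps_X)\<^sup>2 * koebe_fps"
    unfolding koebe_fps_mult by (simp add: mult_ac)
  hence "(1 + fps_X) * ((1 + fps_X) * (fps_X * fps_deriv koebe_fps)) =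
         (1 + fps_X) * ((1 - fps_X) * koebe_fps)"
    by (simp add: algebra_simps power2_eq_square)
  moreover have "(1 + fps_X :: complex fps) \<noteq> 0"
    by (auto simp: fps_eq_iff intro!: exI[of _ 0])
  ultimately show ?thesis by simp
qed

text \<open>
  In the variable s with w = 4 s / (1 + s)^2, which maps the unit disc onto the cut plane,
  the hypergeometric equation has its nonzero finite singularities only at 1 and -1.
\<close>
lemma conv_radius_compose_koebe:
  "fps_conv_radius (hyp2F1_reg_fps a b c oo koebe_fps) \<ge> 1"
proof -
  define F where "F = hyp2F1_reg_fps a b c"
  define G where "G = fps_X * fps_deriv F"
  define f where "f = F oo koebe_fps"
  define g where "g = G oo koebe_fps"
  note [simp] = fps_compose_mult_distrib fps_compose_add_distrib fps_compose_sub_distrib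
  have f': "fps_deriv f = (fps_deriv F oo koebe_fps) * fps_deriv koebe_fps"
    unfolding f_def by (rule fps_compose_deriv) simp
  have g': "fps_deriv g = (fps_deriv G oo koebe_fps) * fps_deriv koebe_fps"
    unfolding g_def by (rule fps_compose_deriv) simp
  have g: "g = koebe_fps * (fps_deriv F oo koebe_fps)"
    unfolding g_def G_def by simp
  have eq1: "(1 + fps_X) * (fps_X * fps_deriv f) = (1 - fps_X) * g"
  proof -
    have "(1 + fps_X) * (fps_X * fps_deriv f) =
            (fps_deriv F oo koebe_fps) * ((1 + fps_X) * (fps_X * fps_deriv koebe_fps))"
      by (simp add: f' mult_ac)
    thus ?thesis unfolding koebe_fps_deriv by (simp add: g mult_ac)
  qed
  have "((1 - fps_X) * fps_X * fps_deriv G) oo koebe_fps =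
    (fps_const (1 - c) * G + fps_X * (fps_const (a + b) * G + fps_const (a * b) * F)) oo koebe_fps"
    unfolding F_def G_def by (subst hyp2F1_reg_fps_ode) (rule refl)
  hence "(1 - koebe_fps) * koebe_fps * (fps_deriv G oo koebe_fps) =
      fps_const (1 - c) * g + koebe_fps * (fps_const (a + b) * g + fps_const (a * b) * f)"
    by (simp add: g_def f_def)
  \<comment> \<open>Denominators are cleared with (1 + s)^2. Since (1 + s)^2 (1 - w) = (1 - s)^2,
    the singularity w = 1 becomes a double factor, one half of which is absorbed by the derivative
    of w.\<close>
  hence "((1 + fps_X)\<^sup>2 - (1 + fps_X)\<^sup>2 * koebe_fps) * koebe_fps * (fps_deriv G oo koebe_fps) =
      fps_const (1 - c) * (1 + fps_X)\<^sup>2 * g +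
        ((1 + fps_X)\<^sup>2 * koebe_fps) * (fps_const (a + b) * g + fps_const (a * b) * f)"
    by algebra
  hence "(1 - fps_X) * ((1 - fps_X) * koebe_fps) * (fps_deriv G oo koebe_fps) =
      fps_const (1 - c) * (1 + fps_X)\<^sup>2 * g +
        4 * fps_X * (fps_const (a + b) * g + fps_const (a * b) * f)"
    unfolding koebe_fps_mult by (simp add: power2_eq_square algebra_simps)
  hence eq2: "(1 - fps_X) * ((1 + fps_X) * (fps_X * fps_deriv g)) =
      fps_const (1 - c) * (1 + fps_X)\<^sup>2 * g +
        4 * fps_X * (fps_const (a + b) * g + fps_const (a * b) * f)"
    unfolding koebe_fps_deriv [symmetric] g' by (simp add: mult_ac)
  have rec_f: "of_nat (n + 2) * f $ (n + 2) = g $ (n + 2) - g $ (n + 1) - of_nat (n + 1) * f $ (n + 1)"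
    for n
    using arg_cong[OF eq1, of "\<lambda>h. h $ (n + 2)"]
    by (simp add: algebra_simps)
  have rec_g: "(of_nat (n + 2) + c - 1) * g $ (n + 2) =
      of_nat n * g $ n + 2 * (1 - c) * g $ (n + 1) + (1 - c) * g $ n +
      4 * (a + b) * g $ (n + 1) + 4 * a * b * f $ (n + 1)" for n
  proof -
    have "(1 - fps_X) * ((1 + fps_X) * (fps_X * fps_deriv g)) =
        fps_X * fps_deriv g - fps_X * (fps_X * (fps_X * fps_deriv g))"
      by (simp add: algebra_simps)
    moreover have "(fps_const (1 - c) * (1 + fps_X)\<^sup>2 * g +
          4 * fps_X * (fps_const (a + b) * g + fps_const (a * b) * f)) =
        fps_const (1 - c) * g + fps_X * (fps_const (2 * (1 - c)) * g) +
        fps_X * (fps_X * (fps_const (1 - c) * g)) +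
        fps_X * (fps_const (4 * (a + b)) * g + fps_const (4 * (a * b)) * f)"
    proof -
      have "fps_const (2 * (1 - c)) = 2 * fps_const (1 - c)"
        "fps_const (4 * (a + b)) = 4 * fps_const (a + b)"
        "fps_const (4 * (a * b)) = 4 * fps_const (a * b)"
        by (simp_all only: numeral_fps_const fps_const_mult)
      thus ?thesis by algebra
    qed
    ultimately have "fps_X * fps_deriv g - fps_X * (fps_X * (fps_X * fps_deriv g)) =
        fps_const (1 - c) * g + fps_X * (fps_const (2 * (1 - c)) * g) +
        fps_X * (fps_X * (fps_const (1 - c) * g)) +
        fps_X * (fps_const (4 * (a + b)) * g + fps_const (4 * (a * b)) * f)"
      using eq2 by simp
    from arg_cong[OF this, of "\<lambda>h. h $ (n + 2)"] show ?thesis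
      by (cases n) (simp_all, simp_all add: algebra_simps)
  qed
  \<comment> \<open>\<open>E\<close> bounds how far n + c - 1 falls short of n in modulus, and
    \<open>D\<close> collects the lower-order coefficients in the recurrence for \<open>g\<close>.
    With \<open>C\<close> = \<open>D\<close> + \<open>E\<close> the inequality (n - 2 + D) n \<le>
    (n - E) (n + C) reduces to (D + E) E \<le> 2 n, which \<open>N\<close> guarantees. The
    recurrence for \<open>f\<close> adds 1 to the constant.\<close>
  define E where "E = norm (c - 1)"
  define D where "D = 3 * norm (1 - c) + 4 * norm (a + b) + 4 * norm (a * b)"
  define C where "C = D + E"
  have DE: "D \<ge> 0" "E \<ge> 0" by (auto simp: D_def E_def)
  define N where "N = nat \<lceil>(D + E) * E + E\<rceil> + 3"
  have "conv_radius (\<lambda>n. f $ n) \<ge> 1"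
  proof (rule conv_radius_ge_1I[where N = N and g = "\<lambda>n. g $ n" and C = "C + 1"])
    fix n B
    assume n: "n \<ge> N" and B: "\<And>k. k < n \<Longrightarrow> norm (f $ k) \<le> B \<and> norm (g $ k) \<le> B"
    from n have "real n \<ge> real N" by simp
    also have "real N \<ge> (D + E) * E + E + 3" unfolding N_def by linarith
    finally have n': "real n \<ge> (D + E) * E + E + 3" .
    define m where "m = n - 2"
    have m: "n = m + 2" using n by (simp add: m_def N_def)
    have B0: "B \<ge> 0" using B[of 0] n order.trans[OF norm_ge_zero[of "f $ 0"], of B] by (simp add: N_def)
    have DE0: "(D + E) * E \<ge> 0" using DE by simp
    have nE: "real n - E > 0" using n' DE0 by linarith
    have "real n - E \<le> norm (of_nat n + c - 1)"
      using norm_diff_ineq[of "of_nat n :: complex" "c - 1"]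
      by (simp add: E_def add_diff_eq)
    hence "(real n - E) * norm (g $ n) \<le> norm ((of_nat n + c - 1) * g $ n)"
      by (simp add: norm_mult mult_right_mono)
    also have "(of_nat n + c - 1) * g $ n = of_nat m * g $ m + 2 * (1 - c) * g $ (m + 1) +
       (1 - c) * g $ m + 4 * (a + b) * g $ (m + 1) + 4 * a * b * f $ (m + 1)"
      using rec_g[of m] by (simp add: m)
    also have "norm \<dots> \<le> real m * B + 2 * norm (1 - c) * B + norm (1 - c) * B +
        4 * norm (a + b) * B + 4 * norm (a * b) * B"
      using B[of m] B[of "m+1"] m
      by (intro norm_triangle_le add_mono)
         (auto simp: norm_mult simp del: distrib_left_numeral right_diff_distrib_numeral
               intro!: mult_left_mono mult_nonneg_nonneg)
    also have "\<dots> = (real n - 2 + D) * B"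
      by (simp add: m D_def algebra_simps)
    also have "\<dots> \<le> (real n - E) * ((1 + C / real n) * B)"
    proof -
      have n0: "real n > 0" using nE DE by linarith
      have "(real n - 2 + D) * real n \<le> (real n - E) * (real n + C)"
        using n' DE0 DE by (simp add: C_def algebra_simps)
      hence "real n - 2 + D \<le> (real n - E) * (1 + C / real n)"
        using n0 by (simp add: field_simps)
      from mult_right_mono[OF this B0] show ?thesis by (simp add: mult_ac)
    qed
    finally have gn: "norm (g $ n) \<le> (1 + C / real n) * B"
      using nE by simp
    have n1: "real n \<ge> 1" using n' DE DE0 by linarith
    have C0: "C \<ge> 0" using DE by (simp add: C_def)
    have "real n * norm (f $ n) = norm (of_nat n * f $ n)" by (simp add: norm_mult)
    also have "of_nat n * f $ n = g $ n - g $ (m + 1) - of_nat (m + 1) * f $ (m + 1)"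
      using rec_f[of m] by (simp add: m)
    also have "norm \<dots> \<le> (1 + C / real n) * B + B + real (m + 1) * B"
      using gn B[of "m+1"] m
      by (intro order.trans[OF norm_triangle_ineq4] add_mono)
         (auto simp del: of_nat_Suc of_nat_add simp: norm_mult intro!: mult_left_mono)
    also have "\<dots> \<le> (real n + (C + 1)) * B"
    proof -
      have "C / real n \<le> C" using n1 C0 by (simp add: divide_le_eq mult_le_cancel_left1)
      hence "1 + C / real n + 1 + real (m + 1) \<le> real n + (C + 1)" by (simp add: m)
      from mult_right_mono[OF this B0] show ?thesis by (simp add: algebra_simps)
    qed
    also have "\<dots> = real n * ((1 + (C + 1) / real n) * B)"
      using n1 by (simp add: field_simps)
    finally have fn: "norm (f $ n) \<le> (1 + (C + 1) / real n) * B"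
      using n1 by simp
    have "(1 + C / real n) * B \<le> (1 + (C + 1) / real n) * B"
      using B0 n1 by (intro mult_right_mono) (auto simp: divide_right_mono)
    with fn gn show "norm (f $ n) \<le> (1 + (C + 1) / real n) * B \<and>
        norm (g $ n) \<le> (1 + (C + 1) / real n) * B" by linarith
  qed
  thus ?thesis unfolding fps_conv_radius_def f_def F_def .
qed

section \<open>The cut plane: existence and uniqueness of the continuation\<close>

abbreviation cut_plane :: "complex set" where
  "cut_plane \<equiv> - complex_of_real ` {1..}"

text \<open>The slit as the branch cut of principal powers of 1 - w, the form in which the side
  conditions for \<open>csqrt\<close> and \<open>powr\<close> arise.\<close>

lemma cut_plane_iff: "w \<in> cut_plane \<longleftrightarrow> 1 - w \<notin> \<real>\<^sub>\<le>\<^sub>0"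
  unfolding complex_slot_right_eq by (auto simp: complex_nonpos_Reals_iff)

lemma open_cut_plane: "open cut_plane"
proof -
  have "cut_plane = (\<lambda>w. 1 - w) -` (- \<real>\<^sub>\<le>\<^sub>0)"
    by (rule set_eqI) (subst cut_plane_iff, simp)
  thus ?thesis
    by (auto intro!: continuous_open_vimage continuous_intros)
qed

lemma connected_cut_plane: "connected cut_plane"
  by (intro starlike_imp_connected starlike_slotted_complex_plane_right)

lemma zero_in_cut_plane [simp]: "0 \<in> cut_plane"
  by auto

lemma koebe_has_fps_expansion: "(\<lambda>s. 4 * s * inverse ((1 + s)\<^sup>2)) has_fps_expansion koebe_fps"
  unfolding koebe_fps_def
  by (intro fps_expansion_intros) (auto simp: power2_eq_square)

text \<open>The series pulled back along the Koebe map converges in the unit disc.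
  \<open>\<sigma>\<close>, the inverse of that map obtained by solving a quadratic equation, sends
  the cut plane into the disc because the principal root of 1 - w has positive real part there;
  composing with it gives the continuation.\<close>

theorem hyp2F1_reg_exists:
  "\<exists>f. f holomorphic_on cut_plane \<and> f has_fps_expansion hyp2F1_reg_fps a b c"
proof -
  define \<sigma> where "\<sigma> w = (1 - csqrt (1 - w)) / (1 + csqrt (1 - w))" for w
  define h where "h = hyp2F1_reg_fps a b c oo koebe_fps"
  have rad: "fps_conv_radius h \<ge> 1"
    unfolding h_def by (rule conv_radius_compose_koebe)
  have Re_pos: "Re (csqrt (1 - w)) > 0" if "w \<in> cut_plane" for w
  proof (rule ccontr)
    define q where "q = csqrt (1 - w)"
    assume "\<not> Re (csqrt (1 - w)) > 0"
    hence "Re q = 0" using csqrt_principal[of "1 - w"] by (auto simp: q_def)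
    moreover have "1 - w = q\<^sup>2" by (simp add: q_def)
    ultimately have "1 - w \<in> \<real>\<^sub>\<le>\<^sub>0" by (simp add: complex_nonpos_Reals_iff power2_eq_square)
    with that show False by (simp add: cut_plane_iff del: Compl_iff)
  qed
  have nz: "1 + csqrt (1 - w) \<noteq> 0" if "w \<in> cut_plane" for w
  proof
    assume "1 + csqrt (1 - w) = 0"
    hence "csqrt (1 - w) = -1" by (metis add_eq_0_iff)
    with Re_pos[OF that] have "Re (-1) > 0" by (simp only:)
    thus False by simp
  qed
  have hol_\<sigma>: "\<sigma> holomorphic_on cut_plane"
    unfolding \<sigma>_def by (intro holomorphic_intros nz) (auto simp: cut_plane_iff simp del: Compl_iff)
  have norm_\<sigma>: "norm (\<sigma> w) < 1" if "w \<in> cut_plane" for w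
  proof -
    have "(norm (1 - q))\<^sup>2 < (norm (1 + q))\<^sup>2" if "Re q > 0" for q :: complex
      using that by (simp only: cmod_power2) (simp add: power2_eq_square algebra_simps)
    from this[OF Re_pos[OF that]]
    have "(norm (1 - csqrt (1 - w)))\<^sup>2 < (norm (1 + csqrt (1 - w)))\<^sup>2" .
    hence "norm (1 - csqrt (1 - w)) < norm (1 + csqrt (1 - w))"
      by (rule power2_less_imp_less) auto
    thus ?thesis using nz[OF that] by (simp add: \<sigma>_def norm_divide)
  qed
  have inv: "4 * \<sigma> w * inverse ((1 + \<sigma> w)\<^sup>2) = w" if "w \<in> cut_plane" for w
  proof -
    define q where "q = csqrt (1 - w)"
    have w: "w = 1 - q\<^sup>2" by (simp add: q_def)
    have q: "1 + q \<noteq> 0" using nz[OF that] by (simp add: q_def)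
    have "1 + \<sigma> w = 2 / (1 + q)" using q by (simp add: \<sigma>_def q_def [symmetric] field_simps)
    hence "4 * \<sigma> w * inverse ((1 + \<sigma> w)\<^sup>2) = 4 * ((1 - q) / (1 + q)) * ((1 + q)\<^sup>2 / 4)"
      by (simp add: \<sigma>_def q_def [symmetric] power_divide)
    also have "\<dots> = (1 - q) * (1 + q)" using q by (simp add: power2_eq_square)
    also have "\<dots> = w" by (simp add: w power2_eq_square algebra_simps)
    finally show ?thesis .
  qed
  have ana: "\<sigma> analytic_on {0}"
    using hol_\<sigma> open_cut_plane zero_in_cut_plane by (meson analytic_at)
  define S where "S = fps_expansion \<sigma> 0"
  have S: "\<sigma> has_fps_expansion S"
    unfolding S_def using ana by (rule analytic_at_imp_has_fps_expansion_0)
  have "\<sigma> 0 = 0" by (simp add: \<sigma>_def)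
  hence S0 [simp]: "S $ 0 = 0"
    using has_fps_expansion_imp_0_eq_fps_nth_0[OF S] by simp
  \<comment> \<open>An identity of functions near 0 becomes one of formal series: \<open>S\<close>
    is a compositional inverse of \<open>koebe_fps\<close>, so composing \<open>h\<close> with
    \<open>S\<close> returns the original coefficients.\<close>
  have comp: "((\<lambda>s. 4 * s * inverse ((1 + s)\<^sup>2)) \<circ> \<sigma>) has_fps_expansion (koebe_fps oo S)"
    by (intro has_fps_expansion_compose koebe_has_fps_expansion S S0)
  have "eventually (\<lambda>w. w \<in> cut_plane) (nhds 0)"
    using open_cut_plane zero_in_cut_plane by (rule eventually_nhds_in_open)
  hence ev: "eventually (\<lambda>w. ((\<lambda>s. 4 * s * inverse ((1 + s)\<^sup>2)) \<circ> \<sigma>) w = w) (nhds 0)"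
    by eventually_elim (use inv in auto)
  have "(\<lambda>w. w) has_fps_expansion (koebe_fps oo S)"
    by (rule iffD1[OF has_fps_expansion_cong[OF ev refl] comp])
  hence X: "koebe_fps oo S = fps_X"
    using fps_expansion_unique_complex has_fps_expansion_fps_X by blast
  have "eval_fps h has_fps_expansion h"
    using rad by (intro eval_fps_has_fps_expansion) (auto intro: less_le_trans[of 0 1])
  hence "(eval_fps h \<circ> \<sigma>) has_fps_expansion (h oo S)"
    by (intro has_fps_expansion_compose S S0)
  also have "h oo S = hyp2F1_reg_fps a b c"
    unfolding h_def by (simp add: fps_compose_assoc [symmetric] X)
  finally have "(eval_fps h \<circ> \<sigma>) has_fps_expansion hyp2F1_reg_fps a b c" .
  moreover have "(eval_fps h \<circ> \<sigma>) holomorphic_on cut_plane"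
  proof (rule holomorphic_on_compose_gen[OF hol_\<sigma>])
    have "ball (0::complex) 1 \<subseteq> eball 0 (fps_conv_radius h)"
    proof
      fix x :: complex assume "x \<in> ball 0 1"
      hence "ereal (norm x) < 1" by simp
      thus "x \<in> eball 0 (fps_conv_radius h)" using rad less_le_trans[of "ereal (norm x)" 1] by simp
    qed
    thus "eval_fps h holomorphic_on ball 0 1"
      by (intro holomorphic_intros)
    show "\<sigma> ` cut_plane \<subseteq> ball 0 1"
      using norm_\<sigma> by (simp add: image_subset_iff del: Compl_iff)
  qed
  ultimately show ?thesis by blast
qed

text \<open>The identity theorem on the cut plane. The contiguous relations and the Pfaff
  transformation are reduced through it to identities between coefficients at 0.\<close>

lemma has_fps_expansion_unique_cut_plane:
  assumes "f holomorphic_on cut_plane" "f has_fps_expansion F"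
    and "g holomorphic_on cut_plane" "g has_fps_expansion F"
    and "w \<in> cut_plane"
  shows "f w = g w"
proof -
  have "(\<lambda>z. f z - g z) has_fps_expansion 0"
    using has_fps_expansion_diff[OF assms(2,4)] by simp
  from has_fps_expansion_0_analytic_continuation[OF this _ open_cut_plane connected_cut_plane
      zero_in_cut_plane assms(5)] assms(1,3)
  show ?thesis by (auto intro: holomorphic_intros)
qed

lemma cut_plane_continuation_eqI:
  assumes "f holomorphic_on cut_plane" "f has_fps_expansion F" "w \<in> cut_plane"
  shows "cut_plane_continuation F w = f w"
proof -
  have "cut_plane_continuation F holomorphic_on cut_plane \<and>
      cut_plane_continuation F has_fps_expansion F"
    unfolding cut_plane_continuation_def by (rule someI[of _ f]) (use assms in blast)
  thus ?thesis using has_fps_expansion_unique_cut_plane assms by blast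
qed

lemma
  shows holomorphic_hyp2F1_reg: "hyp2F1_reg a b c holomorphic_on cut_plane"
    and hyp2F1_reg_has_fps_expansion [fps_expansion_intros]:
      "hyp2F1_reg a b c has_fps_expansion hyp2F1_reg_fps a b c"
  using someI_ex[OF hyp2F1_reg_exists]
  unfolding hyp2F1_reg_def cut_plane_continuation_def by blast+

lemma holomorphic_hyp2F1_reg_compose [holomorphic_intros]:
  assumes "f holomorphic_on A" "\<And>z. z \<in> A \<Longrightarrow> f z \<in> cut_plane"
  shows "(\<lambda>z. hyp2F1_reg a b c (f z)) holomorphic_on A"
  using holomorphic_on_compose_gen[OF assms(1) holomorphic_hyp2F1_reg, of a b c] assms(2)
  by (simp add: o_def image_subset_iff del: Compl_iff)

lemma hyp2F1_reg_0: "hyp2F1_reg a b c 0 = rGamma c"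
  using has_fps_expansion_imp_0_eq_fps_nth_0[OF hyp2F1_reg_has_fps_expansion[of a b c]]
  by (simp add: hyp2F1_reg_fps_def)

lemma hyp2F1_reg_commute: "hyp2F1_reg a b c = hyp2F1_reg b a c"
  by (simp add: hyp2F1_reg_def hyp2F1_reg_fps_def mult.commute mult.left_commute)

text \<open>The bridge back to the unregularized function, crossed at the very end with c = 1 -
  \<mu> and c = 1 + \<mu>.\<close>

lemma hyp2F1_conv_reg:
  assumes "c \<notin> \<int>\<^sub>\<le>\<^sub>0" "w \<in> cut_plane"
  shows "rGamma c * hyp2F1 a b c w = hyp2F1_reg a b c w"
proof -
  have "fps_const (Gamma c) * hyp2F1_reg_fps a b c = fps_hypergeo [a, b] [c] 1"
    using assms(1) by (simp add: hyp2F1_reg_fps_conv_hypergeo rGamma_inverse_Gamma Gamma_eq_zero_iff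
       mult.assoc [symmetric] del: fps_const_mult_left)
  hence "(\<lambda>w. Gamma c * hyp2F1_reg a b c w) has_fps_expansion fps_hypergeo [a, b] [c] 1"
    using has_fps_expansion_cmult_left[OF hyp2F1_reg_has_fps_expansion[of a b c], of "Gamma c"] by simp
  hence "hyp2F1 a b c w = Gamma c * hyp2F1_reg a b c w"
    unfolding hyp2F1_def
    by (intro cut_plane_continuation_eqI assms holomorphic_intros) auto
  thus ?thesis using assms(1) by (simp add: rGamma_inverse_Gamma Gamma_eq_zero_iff)
qed

section \<open>Contiguous relations for the regularized function\<close>

lemma rGamma_rec: "rGamma z = z * rGamma (z + 1)"
  by (simp add: rGamma_plus1)

text \<open>Tailored to Q: lowering \<nu> by one turns the numerator parameters (\<nu> + \<mu> +
  2)/2, (\<nu> + \<mu> + 1)/2 into (\<nu> + \<mu> + 1)/2, (\<nu> + \<mu>)/2. After swapping them,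
  one is unchanged and the other drops by one, together with the lower parameter.\<close>

lemma hyp2F1_reg_lower:
  assumes w: "w \<in> cut_plane"
  shows "hyp2F1_reg a b c w = (1 - w) * (w * deriv (hyp2F1_reg (a + 1) b (c + 1)) w) +
           (c - b * w) * hyp2F1_reg (a + 1) b (c + 1) w"
proof (rule has_fps_expansion_unique_cut_plane[OF _ _ _ _ w])
  define F where "F = hyp2F1_reg_fps (a + 1) b (c + 1)"
  show "(\<lambda>w. (1 - w) * (w * deriv (hyp2F1_reg (a + 1) b (c + 1)) w) +
           (c - b * w) * hyp2F1_reg (a + 1) b (c + 1) w) has_fps_expansion
        (1 - fps_X) * (fps_X * fps_deriv F) + (fps_const c - fps_const b * fps_X) * F"
    unfolding F_def by (intro fps_expansion_intros)
  have "(1 - fps_X) * (fps_X * fps_deriv F) + (fps_const c - fps_const b * fps_X) * F =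
      hyp2F1_reg_fps a b c" (is "?lhs = _")
  proof (rule fps_ext)
    fix n
    show "?lhs $ n = hyp2F1_reg_fps a b c $ n"
    proof (cases n)
      case 0
      thus ?thesis using rGamma_rec[of c]
        by (simp add: hyp2F1_reg_fps_def F_def left_diff_distrib mult.assoc)
    next
      case (Suc m)
      have "?lhs $ Suc m = (of_nat (Suc m) + c) * F $ Suc m - (of_nat m + b) * F $ m"
        by (cases m) (simp_all add: left_diff_distrib mult.assoc, simp_all add: algebra_simps)
      also have "\<dots> = hyp2F1_reg_fps a b c $ Suc m"
      proof -
        \<comment> \<open>All three coefficients are polynomial multiples of \<open>t\<close>, which
          carries the reciprocal Gamma value with the largest argument. What remains is a polynomial
          identity, valid for every c.\<close>
        define t where "t = rGamma (c + of_nat m + 2) / fact (Suc m)"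
        have r: "rGamma (c + 1 + of_nat m) = (c + 1 + of_nat m) * rGamma (c + of_nat m + 2)"
          using rGamma_rec[of "c + 1 + of_nat m"] by (simp add: add_ac)
        have "F $ Suc m = pochhammer (a + 1) m * (a + 1 + of_nat m) *
            (pochhammer b m * (b + of_nat m)) * t"
          by (simp add: F_def hyp2F1_reg_fps_def t_def pochhammer_Suc add_ac)
        moreover have "F $ m = pochhammer (a + 1) m * pochhammer b m * (c + 1 + of_nat m) *
            of_nat (Suc m) * t"
          by (simp add: F_def hyp2F1_reg_fps_def t_def r del: of_nat_Suc)
        moreover have "hyp2F1_reg_fps a b c $ Suc m = a * pochhammer (a + 1) m *
            (pochhammer b m * (b + of_nat m)) * (c + 1 + of_nat m) * t"
          using r by (simp add: hyp2F1_reg_fps_def t_def pochhammer_Suc[of b] pochhammer_rec[of a] add_ac)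
        ultimately show ?thesis unfolding of_nat_Suc by algebra
      qed
      finally show ?thesis by (simp add: Suc)
    qed
  qed
  with hyp2F1_reg_has_fps_expansion[of a b c] show "hyp2F1_reg a b c has_fps_expansion ?lhs"
    by simp
qed (intro holomorphic_intros holomorphic_hyp2F1_reg open_cut_plane, simp?)+

text \<open>On coefficients the right-hand side produces a + n times (c + n) - (b + n), and this
  difference is independent of n. It is the step opposite to
  \<open>hyp2F1_reg_lower\<close>.\<close>

lemma hyp2F1_reg_raise:
  assumes w: "w \<in> cut_plane"
  shows "a * (c - b) * hyp2F1_reg (a + 1) b (c + 1) w =
     a * hyp2F1_reg a b c w - (1 - w) * deriv (hyp2F1_reg a b c) w"
proof (rule has_fps_expansion_unique_cut_plane[OF _ _ _ _ w])
  define F where "F = hyp2F1_reg_fps a b c"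
  show "(\<lambda>w. a * hyp2F1_reg a b c w - (1 - w) * deriv (hyp2F1_reg a b c) w) has_fps_expansion
        fps_const a * F - (1 - fps_X) * fps_deriv F"
    unfolding F_def by (intro fps_expansion_intros)
  have "fps_const a * F - (1 - fps_X) * fps_deriv F =
      fps_const (a * (c - b)) * hyp2F1_reg_fps (a + 1) b (c + 1)" (is "?lhs = ?rhs")
  proof (rule fps_ext)
    fix n
    have "?lhs $ n = (a + of_nat n) * F $ n - of_nat (Suc n) * F $ Suc n"
      by (cases n) (simp_all add: left_diff_distrib, simp_all add: algebra_simps)
    also have "\<dots> = ?rhs $ n"
    proof -
      have "a * pochhammer (a + 1) n = pochhammer a n * (a + of_nat n)"
        by (metis pochhammer_rec pochhammer_Suc)
      moreover define t where "t = rGamma (c + of_nat n + 1) / fact n"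
      have "F $ n = pochhammer a n * pochhammer b n * (c + of_nat n) * t"
        using rGamma_rec[of "c + of_nat n"] by (simp add: F_def hyp2F1_reg_fps_def t_def)
      moreover have "of_nat (Suc n) * F $ Suc n = pochhammer a n * (a + of_nat n) *
          (pochhammer b n * (b + of_nat n)) * t"
        by (simp add: F_def hyp2F1_reg_fps_def t_def pochhammer_Suc add_ac del: of_nat_Suc)
           (simp add: add_ac)
      moreover have "?rhs $ n = a * (c - b) * pochhammer (a + 1) n * pochhammer b n * t"
        by (simp add: hyp2F1_reg_fps_def t_def add_ac)
      ultimately show ?thesis by algebra
    qed
    finally show "?lhs $ n = ?rhs $ n" .
  qed
  moreover have "(\<lambda>w. a * (c - b) * hyp2F1_reg (a + 1) b (c + 1) w) has_fps_expansion ?rhs"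
    by (intro fps_expansion_intros)
  ultimately show "(\<lambda>w. a * (c - b) * hyp2F1_reg (a + 1) b (c + 1) w) has_fps_expansion ?lhs"
    by simp
qed (intro holomorphic_intros holomorphic_hyp2F1_reg open_cut_plane, simp?)+

text \<open>The degree shift for P, where the numerator parameters move in opposite directions and
  c, which depends only on the order, stays fixed.\<close>

lemma hyp2F1_reg_legendre_lower:
  assumes w: "w \<in> cut_plane"
  shows "(\<nu> + 1 - c) * hyp2F1_reg (1 - \<nu>) \<nu> c w =
     (\<nu> + 1 - c - 2 * \<nu> * w) * hyp2F1_reg (-\<nu>) (\<nu> + 1) c w -
     2 * (1 - w) * (w * deriv (hyp2F1_reg (-\<nu>) (\<nu> + 1) c) w)"
proof (rule has_fps_expansion_unique_cut_plane[OF _ _ _ _ w])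
  define F where "F = hyp2F1_reg_fps (-\<nu>) (\<nu> + 1) c"
  show "(\<lambda>w. (\<nu> + 1 - c - 2 * \<nu> * w) * hyp2F1_reg (-\<nu>) (\<nu> + 1) c w -
     2 * (1 - w) * (w * deriv (hyp2F1_reg (-\<nu>) (\<nu> + 1) c) w)) has_fps_expansion
        (fps_const (\<nu> + 1 - c) - fps_const (2 * \<nu>) * fps_X) * F
          - fps_const 2 * (1 - fps_X) * (fps_X * fps_deriv F)"
    unfolding F_def by (intro fps_expansion_intros)
  have "(fps_const (\<nu> + 1 - c) - fps_const (2 * \<nu>) * fps_X) * F
          - fps_const 2 * (1 - fps_X) * (fps_X * fps_deriv F) =
      fps_const (\<nu> + 1 - c) * hyp2F1_reg_fps (1 - \<nu>) \<nu> c" (is "?lhs = ?rhs")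
  proof (rule fps_ext)
    fix n
    show "?lhs $ n = ?rhs $ n"
    proof (cases n)
      case 0
      thus ?thesis
        by (simp add: hyp2F1_reg_fps_def F_def left_diff_distrib mult.assoc)
    next
      case (Suc m)
      have "?lhs $ Suc m = (\<nu> + 1 - c - 2 * of_nat (Suc m)) * F $ Suc m +
          2 * (of_nat m - \<nu>) * F $ m"
        by (cases m) (simp_all add: left_diff_distrib right_diff_distrib mult.assoc, simp_all add: algebra_simps)
      also have "\<dots> = ?rhs $ Suc m"
      proof -
        have "- \<nu> * pochhammer (1 - \<nu>) m = pochhammer (-\<nu>) m * (of_nat m - \<nu>)"
          using pochhammer_rec[of "-\<nu>" m] pochhammer_Suc[of "-\<nu>" m] by (simp add: algebra_simps)
        moreover define t where "t = rGamma (c + of_nat m + 1) / fact (Suc m)"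
        have "F $ m = pochhammer (-\<nu>) m * pochhammer (\<nu> + 1) m * (c + of_nat m) * of_nat (Suc m) * t"
          using rGamma_rec[of "c + of_nat m"]
          by (simp add: F_def hyp2F1_reg_fps_def t_def del: of_nat_Suc)
        moreover have "F $ Suc m = - \<nu> * pochhammer (1 - \<nu>) m *
            (pochhammer (\<nu> + 1) m * (\<nu> + 1 + of_nat m)) * t"
          by (simp add: F_def hyp2F1_reg_fps_def t_def pochhammer_Suc[of "1 + \<nu>"]
              pochhammer_rec[of "-\<nu>"] add_ac)
        moreover have "?rhs $ Suc m = (\<nu> + 1 - c) * (pochhammer (1 - \<nu>) m * (1 - \<nu> + of_nat m)) *
            (\<nu> * pochhammer (\<nu> + 1) m) * t"
          by (simp add: hyp2F1_reg_fps_def t_def pochhammer_Suc[of "1 - \<nu>"]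
              pochhammer_rec[of \<nu>] add_ac)
        ultimately show ?thesis unfolding of_nat_Suc by algebra
      qed
      finally show ?thesis by (simp add: Suc)
    qed
  qed
  moreover have "(\<lambda>w. (\<nu> + 1 - c) * hyp2F1_reg (1 - \<nu>) \<nu> c w) has_fps_expansion ?rhs"
    by (intro fps_expansion_intros)
  ultimately show "(\<lambda>w. (\<nu> + 1 - c) * hyp2F1_reg (1 - \<nu>) \<nu> c w) has_fps_expansion ?lhs"
    by simp
qed (intro holomorphic_intros holomorphic_hyp2F1_reg open_cut_plane, simp?)+

section \<open>The Pfaff transformation\<close>

text \<open>At order n + 1 the equation multiplies the new coefficient by (n + 1)(c + n), which is
  nonzero for such c; the constant term therefore determines the series.\<close>

lemma hyp2F1_reg_fps_ode_unique:
  fixes f :: "complex fps"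
  assumes c: "c \<notin> \<int>\<^sub>\<le>\<^sub>0" and f0: "f $ 0 = rGamma c"
  defines "g \<equiv> fps_X * fps_deriv f"
  assumes ode: "(1 - fps_X) * fps_X * fps_deriv g =
      fps_const (1 - c) * g + fps_X * (fps_const (a + b) * g + fps_const (a * b) * f)"
  shows "f = hyp2F1_reg_fps a b c"
proof (rule fps_ext)
  fix n
  show "f $ n = hyp2F1_reg_fps a b c $ n"
  proof (induction n)
    case 0
    thus ?case by (simp add: f0 hyp2F1_reg_fps_def)
  next
    case (Suc n)
    have g: "g $ k = of_nat k * f $ k" for k
      unfolding g_def by (cases k) auto
    have "((1 - fps_X) * fps_X * fps_deriv g) $ Suc n = of_nat (Suc n) * g $ Suc n - of_nat n * g $ n"
      by (cases n) (simp_all add: left_diff_distrib mult.assoc del: of_nat_Suc)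
    moreover have "(fps_const (1 - c) * g +
          fps_X * (fps_const (a + b) * g + fps_const (a * b) * f)) $ Suc n =
        (1 - c) * g $ Suc n + (a + b) * g $ n + a * b * f $ n"
      by simp
    ultimately have "of_nat (Suc n) * (c + of_nat n) * f $ Suc n = (a + of_nat n) * (b + of_nat n) * f $ n"
      unfolding ode g by (simp only: of_nat_Suc) algebra
    also have "\<dots> = of_nat (Suc n) * (c + of_nat n) * hyp2F1_reg_fps a b c $ Suc n"
      by (simp only: Suc.IH hyp2F1_reg_fps_Suc)
    finally show ?case
      using c plus_of_nat_eq_0_imp[of c n] by (auto simp del: of_nat_Suc)
  qed
qed

text \<open>\<open>T\<close> is the series of w / (w - 1), and the binomial factor is (1 - w)^(-a).
  The product is shown to solve the equation with parameters a, b, c; uniqueness of its power series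
  solution then identifies it.\<close>

lemma fps_pfaff:
  fixes a b c :: complex
  assumes c: "c \<notin> \<int>\<^sub>\<le>\<^sub>0"
  defines "T \<equiv> - fps_X * inverse (1 - fps_X :: complex fps)"
  shows "(fps_binomial (-a) oo (- fps_X)) * (hyp2F1_reg_fps a (c - b) c oo T) = hyp2F1_reg_fps a b c"
proof -
  define A where "A = (fps_binomial (-a) oo (- fps_X))"
  define H where "H = hyp2F1_reg_fps a (c - b) c"
  define K where "K = fps_X * fps_deriv H"
  define h where "h = H oo T"
  define k where "k = K oo T"
  define M where "M = T * (fps_deriv K oo T)"
  define f where "f = A * h"
  define g where "g = fps_X * fps_deriv f"
  have T0 [simp]: "T $ 0 = 0" by (simp add: T_def)
  have T: "(1 - fps_X) * T = - fps_X"
  proof -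
    have "inverse (1 - fps_X) * (1 - fps_X :: complex fps) = 1"
      by (rule inverse_mult_eq_1) simp
    thus ?thesis unfolding T_def by algebra
  qed
  have nz: "(1 - fps_X :: complex fps) \<noteq> 0" by (auto simp: fps_eq_iff intro!: exI[of _ 0])
  have "fps_deriv ((1 - fps_X) * T) = - 1" unfolding T by simp
  hence T': "(1 - fps_X) * fps_deriv T - T = - 1" by simp
  \<comment> \<open>The Euler derivative of \<open>T\<close> is \<open>T\<close> / (1 - X), so Euler
    derivatives in the old and new variables differ only by the factor 1 - X.\<close>
  have "(1 - fps_X) * ((1 - fps_X) * (fps_X * fps_deriv T)) = (1 - fps_X) * T"
    using T T' by algebra
  hence XT': "(1 - fps_X) * (fps_X * fps_deriv T) = T" using nz by simp
  have A': "(1 - fps_X) * fps_deriv A = fps_const a * A"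
  proof -
    have "(1 + fps_X) * fps_deriv (fps_binomial (-a)) = fps_const (-a) * fps_binomial (-a)"
      by (simp add: fps_binomial_deriv fps_divide_unit mult_ac inverse_mult_eq_1')
    hence "((1 + fps_X) * fps_deriv (fps_binomial (-a))) oo (- fps_X) =
        (fps_const (-a) * fps_binomial (-a)) oo (- fps_X)" by simp
    moreover have "fps_deriv A = - (fps_deriv (fps_binomial (-a)) oo (- fps_X))"
      unfolding A_def by (subst fps_compose_deriv) auto
    ultimately show ?thesis
      by (simp add: A_def fps_compose_mult_distrib fps_compose_add_distrib fps_compose_uminus
          flip: fps_const_neg)
  qed
  have h': "fps_deriv h = (fps_deriv H oo T) * fps_deriv T"
    unfolding h_def by (rule fps_compose_deriv) simp
  have k': "fps_deriv k = (fps_deriv K oo T) * fps_deriv T"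
    unfolding k_def by (rule fps_compose_deriv) simp
  have k: "k = T * (fps_deriv H oo T)"
    unfolding k_def K_def by (simp add: fps_compose_mult_distrib)
  have Xh: "(1 - fps_X) * (fps_X * fps_deriv h) = k"
  proof -
    have "(1 - fps_X) * (fps_X * fps_deriv h) =
        ((1 - fps_X) * (fps_X * fps_deriv T)) * (fps_deriv H oo T)"
      unfolding h' by (simp only: mult_ac)
    thus ?thesis unfolding XT' k .
  qed
  have Xk: "(1 - fps_X) * (fps_X * fps_deriv k) = M"
  proof -
    have "(1 - fps_X) * (fps_X * fps_deriv k) =
        ((1 - fps_X) * (fps_X * fps_deriv T)) * (fps_deriv K oo T)"
      unfolding k' by (simp only: mult_ac)
    thus ?thesis unfolding XT' M_def .
  qed
  have "((1 - fps_X) * fps_X * fps_deriv K) oo T =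
      (fps_const (1 - c) * K + fps_X * (fps_const (a + (c - b)) * K + fps_const (a * (c - b)) * H)) oo T"
    unfolding K_def H_def by (subst hyp2F1_reg_fps_ode) (rule refl)
  hence "(1 - T) * M = fps_const (1 - c) * k +
      T * (fps_const (a + (c - b)) * k + fps_const (a * (c - b)) * h)"
    by (simp add: M_def k_def h_def fps_compose_mult_distrib fps_compose_add_distrib
          fps_compose_sub_distrib mult.assoc)
  hence "(1 - fps_X) * ((1 - T) * M) = (1 - fps_X) * (fps_const (1 - c) * k +
      T * (fps_const (a + (c - b)) * k + fps_const (a * (c - b)) * h))"
    by (simp only:)
  hence "((1 - fps_X) - (1 - fps_X) * T) * M = (1 - fps_X) * (fps_const (1 - c) * k) +
      ((1 - fps_X) * T) * (fps_const (a + (c - b)) * k + fps_const (a * (c - b)) * h)"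
    by (simp add: algebra_simps)
  \<comment> \<open>Here the equation for \<open>H\<close> eliminates \<open>M\<close>, the
    second-order quantity. Everything left is linear in \<open>h\<close> and
    \<open>k\<close>.\<close>
  hence M: "M = (1 - fps_X) * (fps_const (1 - c) * k) -
      fps_X * (fps_const (a + (c - b)) * k + fps_const (a * (c - b)) * h)"
    unfolding T by simp
  have "fps_deriv f = fps_deriv A * h + A * fps_deriv h"
    by (simp add: f_def)
  hence "(1 - fps_X) * g =
      fps_X * ((1 - fps_X) * fps_deriv A) * h + A * ((1 - fps_X) * (fps_X * fps_deriv h))"
    unfolding g_def by (simp only: algebra_simps)
  hence g: "(1 - fps_X) * g = fps_const a * fps_X * A * h + A * k"
    unfolding A' Xh by (simp only: mult_ac)
  have g': "(1 - fps_X) * fps_deriv g - g = fps_const a * A * h +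
      fps_const a * fps_X * (fps_deriv A * h + A * fps_deriv h) + fps_deriv A * k + A * fps_deriv k"
  proof -
    have "(1 - fps_X) * fps_deriv g - g = fps_deriv ((1 - fps_X) * g)"
      by simp
    also have "\<dots> = fps_deriv (fps_const a * fps_X * A * h + A * k)"
      by (simp only: g)
    also have "\<dots> = fps_const a * A * h +
      fps_const a * fps_X * (fps_deriv A * h + A * fps_deriv h) + fps_deriv A * k + A * fps_deriv k"
      by (simp only: fps_deriv_mult fps_deriv_add fps_deriv_fps_X fps_deriv_const
            mult_zero_left mult_zero_right mult_1_left mult_1_right add_0_left add_0_right
            distrib_left distrib_right mult_ac add_ac)
    finally show ?thesis .
  qed
  have const_eqs: "fps_const (a + (c - b)) = fps_const a + (fps_const c - fps_const b)"
    "fps_const (a * (c - b)) = fps_const a * (fps_const c - fps_const b)"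
    "fps_const (1 - c) = 1 - fps_const c" "fps_const (a + b) = fps_const a + fps_const b"
    "fps_const (a * b) = fps_const a * fps_const b"
    by (simp_all only: fps_const_add [symmetric] fps_const_sub [symmetric] fps_const_mult [symmetric] fps_const_1_eq_1)
  \<comment> \<open>The additional factor 1 - X clears the denominators that come from
    \<open>A\<close> and \<open>T\<close>; it is cancelled afterwards.\<close>
  have "(1 - fps_X) * ((1 - fps_X) * fps_X * fps_deriv g) =
    (1 - fps_X) * (fps_const (1 - c) * g + fps_X * (fps_const (a + b) * g + fps_const (a * b) * f))"
  proof -
    note ring = algebra_simps mult_1_left mult_1_right
    have e1: "(1 - fps_X) * ((1 - fps_X) * fps_X * fps_deriv g) =
        fps_X * (1 - fps_X) * ((1 - fps_X) * fps_deriv g - g) + fps_X * ((1 - fps_X) * g)"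
      by (simp only: ring)
    have e2: "fps_X * (1 - fps_X) * ((1 - fps_X) * fps_deriv g - g) =
        fps_const a * fps_X * (1 - fps_X) * A * h +
        fps_const a * fps_X * (fps_X * ((1 - fps_X) * fps_deriv A) * h +
        A * ((1 - fps_X) * (fps_X * fps_deriv h))) +
        fps_X * ((1 - fps_X) * fps_deriv A) * k + A * ((1 - fps_X) * (fps_X * fps_deriv k))"
      unfolding g' by (simp only: ring)
    have e3: "(1 - fps_X) *
        (fps_const (1 - c) * g + fps_X * (fps_const (a + b) * g + fps_const (a * b) * f)) =
      fps_const (1 - c) * ((1 - fps_X) * g) +
        fps_X * (fps_const (a + b) * ((1 - fps_X) * g) + fps_const (a * b) * (1 - fps_X) * f)"
      by (simp only: ring)
    show ?thesis
      unfolding e1 e2 e3 A' Xh Xk g unfolding M f_def const_eqs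
      by (simp only: ring)
  qed
  hence ode: "(1 - fps_X) * fps_X * fps_deriv g =
    fps_const (1 - c) * g + fps_X * (fps_const (a + b) * g + fps_const (a * b) * f)"
    by (rule mult_left_cancel[OF nz, THEN iffD1])
  have "f $ 0 = rGamma c"
    by (simp add: f_def A_def h_def H_def hyp2F1_reg_fps_def)
  hence "f = hyp2F1_reg_fps a b c"
    using ode unfolding g_def by (intro hyp2F1_reg_fps_ode_unique c)
  thus ?thesis by (simp add: f_def A_def h_def H_def)
qed

theorem hyp2F1_reg_pfaff:
  assumes c: "c \<notin> \<int>\<^sub>\<le>\<^sub>0" and w: "w \<in> cut_plane"
  shows "hyp2F1_reg a b c w = (1 - w) powr (-a) * hyp2F1_reg a (c - b) c (w / (w - 1))"
proof -
  \<comment> \<open>The map w / (w - 1) preserves the cut plane, because 1 minus its value is 1 / (1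
    - w) and inversion preserves the complement of the nonpositive real axis.\<close>
  have *: "- w * inverse (1 - w) \<in> cut_plane" if "w \<in> cut_plane" for w
  proof -
    have 1: "1 - w \<notin> \<real>\<^sub>\<le>\<^sub>0" using that by (simp add: cut_plane_iff del: Compl_iff)
    hence "1 - w \<noteq> 0" by (metis nonpos_Reals_zero_I)
    hence "1 - (- w * inverse (1 - w)) = inverse (1 - w)"
      by (simp add: divide_simps)
    thus ?thesis unfolding cut_plane_iff using 1 by simp
  qed
  have "hyp2F1_reg a b c w = (1 + - w) powr (-a) * hyp2F1_reg a (c - b) c (- w * inverse (1 - w))"
  proof (rule has_fps_expansion_unique_cut_plane[OF _ _ _ _ w])
    have exp1: "((\<lambda>w. (1 + w) powr (-a)) \<circ> (\<lambda>w. - w)) has_fps_expansion (fps_binomial (-a) oo (- fps_X))"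
      by (intro has_fps_expansion_compose has_fps_expansion_binomial_complex has_fps_expansion_minus
            has_fps_expansion_fps_X) simp
    have "(\<lambda>w::complex. - w * inverse (1 - w)) has_fps_expansion
        (- fps_X * inverse (1 - fps_X))"
      by (intro has_fps_expansion_mult has_fps_expansion_inverse has_fps_expansion_minus
            has_fps_expansion_diff has_fps_expansion_1 has_fps_expansion_fps_X) simp
    hence exp2: "(hyp2F1_reg a (c - b) c \<circ> (\<lambda>w. - w * inverse (1 - w))) has_fps_expansion
       (hyp2F1_reg_fps a (c - b) c oo (- fps_X * inverse (1 - fps_X)))"
      by (rule has_fps_expansion_compose[OF hyp2F1_reg_has_fps_expansion]) simp
    show "(\<lambda>w. (1 + - w) powr (-a) * hyp2F1_reg a (c - b) c (- w * inverse (1 - w)))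
        has_fps_expansion hyp2F1_reg_fps a b c"
      using has_fps_expansion_mult[OF exp1 exp2] unfolding fps_pfaff[OF c] o_def .
    show "(\<lambda>w. (1 + - w) powr (-a) * hyp2F1_reg a (c - b) c (- w * inverse (1 - w)))
        holomorphic_on cut_plane"
      using * by (intro holomorphic_intros) (auto simp: cut_plane_iff simp del: Compl_iff)
  qed (rule holomorphic_hyp2F1_reg hyp2F1_reg_has_fps_expansion)+
  also have "- w * inverse (1 - w) = w / (w - 1)"
    using w by (auto simp: divide_simps) (simp add: algebra_simps)
  finally show ?thesis by simp
qed

section \<open>Gauss's summation theorem\<close>

lemma hyp2F1_reg_sums:
  assumes "norm w < 1"
  shows "hyp2F1_reg a b c w = (\<Sum>n. hyp2F1_reg_fps a b c $ n * w ^ n)"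
proof -
  have "ball (0::complex) 1 \<subseteq> cut_plane"
  proof
    fix z :: complex assume "z \<in> ball 0 1"
    hence "Re z < 1" using complex_Re_le_cmod[of z] by simp
    thus "z \<in> cut_plane" by auto
  qed
  hence "hyp2F1_reg a b c holomorphic_on ball 0 1"
    using holomorphic_hyp2F1_reg holomorphic_on_subset by blast
  from has_fps_expansion_imp_eval_fps_eq[OF hyp2F1_reg_has_fps_expansion assms this]
  show ?thesis by (simp add: eval_fps_def)
qed

lemma pochhammer_rGamma_series:
  "pochhammer z (Suc n) = rGamma_series z n * (fact n * exp (z * of_real (ln (of_nat n))))"
  for z :: complex
  by (simp add: rGamma_series_def)

text \<open>Each Pochhammer symbol is expressed by Euler's limit for 1 / Gamma. The coefficient then
  is the convergent, hence bounded, factor \<open>X\<close> n times n^(a + b - c) / (n + 1).\<close>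

lemma hyp2F1_reg_fps_bound:
  assumes c: "c \<notin> \<int>\<^sub>\<le>\<^sub>0"
  obtains B where "B \<ge> 0"
    "\<And>n. n > 0 \<Longrightarrow> norm (hyp2F1_reg_fps a b c $ Suc n) \<le> B * real n powr (-1 - Re (c - a - b))"
proof -
  define X where "X n = rGamma_series a n * rGamma_series b n * rGamma c / rGamma_series c n" for n
  have rc: "rGamma c \<noteq> 0" using c by (simp add: rGamma_eq_zero_iff)
  have "X \<longlonglongrightarrow> rGamma a * rGamma b * rGamma c / rGamma c"
    unfolding X_def by (intro tendsto_intros rc)
  hence "Bseq X" by (intro convergent_imp_Bseq convergentI)
  then obtain B where B: "B > 0" "\<And>n. norm (X n) \<le> B"
    by (auto elim!: BseqE)
  show ?thesis
  proof
    fix n :: nat assume n: "n > 0"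
    define e where "e = exp ((a + b - c) * of_real (ln (of_nat n)) :: complex)"
    have e: "e = exp (a * of_real (ln (of_nat n))) * exp (b * of_real (ln (of_nat n))) /
        exp (c * of_real (ln (of_nat n)))"
      by (simp add: e_def algebra_simps exp_add exp_diff)
    have "pochhammer c (Suc n) \<noteq> 0" using c by (auto simp: pochhammer_eq_0_iff)
    hence "rGamma (c + of_nat (Suc n)) = rGamma c / pochhammer c (Suc n)"
      using pochhammer_rGamma[of c "Suc n"] by (simp add: field_simps)
    hence "hyp2F1_reg_fps a b c $ Suc n = X n * e / of_nat (Suc n)"
      unfolding hyp2F1_reg_fps_def fps_nth_Abs_fps pochhammer_rGamma_series X_def e
      by (simp add: fact_Suc del: of_nat_Suc) (simp add: mult_ac)
    hence "norm (hyp2F1_reg_fps a b c $ Suc n) = norm (X n) * (norm e / real (Suc n))"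
      by (simp add: norm_mult norm_divide del: of_nat_Suc)
    also have "\<dots> \<le> B * (norm e / real n)"
      using n B by (intro mult_mono divide_left_mono) auto
    also have "norm e = real n powr (- Re (c - a - b))"
      using n by (simp add: e_def powr_def algebra_simps)
    also have "\<dots> / real n = real n powr (-1 - Re (c - a - b))"
      using n powr_diff[of "real n" "- Re (c - a - b)" 1] by (simp add: algebra_simps)
    finally show "norm (hyp2F1_reg_fps a b c $ Suc n) \<le> B * real n powr (-1 - Re (c - a - b))" .
  qed (use B in auto)
qed

context
  fixes a b c :: complex
  assumes c: "c \<notin> \<int>\<^sub>\<le>\<^sub>0" and Re_pos: "Re (c - a - b) > 0"
begin

lemma summable_hyp2F1_reg_fps: "summable (\<lambda>n. norm (hyp2F1_reg_fps a b c $ n))"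
proof -
  obtain B where B: "B \<ge> 0"
    "\<And>n. n > 0 \<Longrightarrow> norm (hyp2F1_reg_fps a b c $ Suc n) \<le> B * real n powr (-1 - Re (c - a - b))"
    using hyp2F1_reg_fps_bound[OF c] by blast
  have "summable (\<lambda>n. norm (hyp2F1_reg_fps a b c $ Suc n))"
  proof (rule summable_comparison_test)
    show "\<exists>N. \<forall>n\<ge>N. norm (norm (hyp2F1_reg_fps a b c $ Suc n)) \<le> B * real n powr (-1 - Re (c - a - b))"
      using B by (intro exI[of _ 1]) auto
    show "summable (\<lambda>n. B * real n powr (-1 - Re (c - a - b)))"
      using Re_pos by (intro summable_mult) (simp add: summable_real_powr_iff)
  qed
  thus ?thesis by (subst (asm) summable_Suc_iff)
qed

text \<open>This kills the boundary term of the telescoping sum behind Gauss's theorem.\<close>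

lemma hyp2F1_reg_fps_nth_mult_tendsto_0: "(\<lambda>n. of_nat n * hyp2F1_reg_fps a b c $ n) \<longlonglongrightarrow> 0"
proof -
  obtain B where B: "B \<ge> 0"
    "\<And>n. n > 0 \<Longrightarrow> norm (hyp2F1_reg_fps a b c $ Suc n) \<le> B * real n powr (-1 - Re (c - a - b))"
    using hyp2F1_reg_fps_bound[OF c] by blast
  have "(\<lambda>n. of_nat (Suc n) * hyp2F1_reg_fps a b c $ Suc n) \<longlonglongrightarrow> 0"
  proof (rule Lim_null_comparison)
    show "eventually (\<lambda>n. norm (of_nat (Suc n) * hyp2F1_reg_fps a b c $ Suc n) \<le>
        2 * B * real n powr (- Re (c - a - b))) sequentially"
      using eventually_gt_at_top[of 0]
    proof eventually_elim
      case (elim n)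
      have "norm (of_nat (Suc n) * hyp2F1_reg_fps a b c $ Suc n) \<le>
          (2 * real n) * (B * real n powr (-1 - Re (c - a - b)))"
        unfolding norm_mult norm_of_nat using elim B by (intro mult_mono) auto
      also have "\<dots> = 2 * B * (real n * real n powr (-1 - Re (c - a - b)))" by simp
      also have "real n * real n powr (-1 - Re (c - a - b)) = real n powr (- Re (c - a - b))"
      proof -
        have "real n * real n powr (-1 - Re (c - a - b)) =
            real n powr (1 + (-1 - Re (c - a - b)))"
          using elim by (simp only: powr_add) simp
        thus ?thesis by (simp add: algebra_simps)
      qed
      finally show ?case .
    qed
    have "(\<lambda>n. real n powr (- Re (c - a - b))) \<longlonglongrightarrow> 0"
      using Re_pos by (intro tendsto_neg_powr filterlim_real_sequentially) auto
    thus "(\<lambda>n. 2 * B * real n powr (- Re (c - a - b))) \<longlonglongrightarrow> 0"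
      by (rule tendsto_mult_right_zero)
  qed
  thus ?thesis by (subst (asm) filterlim_sequentially_Suc)
qed

text \<open>The point 1 lies on the cut, so the sum of the series there can only be met as a limit
  from the left. Absolute convergence at 1 dominates all the series on (0, 1).\<close>

lemma hyp2F1_reg_at_left_1:
  "((\<lambda>x. hyp2F1_reg a b c (of_real x)) \<longlongrightarrow> (\<Sum>n. hyp2F1_reg_fps a b c $ n)) (at_left 1)"
proof -
  have "((\<lambda>x. \<Sum>n. hyp2F1_reg_fps a b c $ n * of_real x ^ n) \<longlongrightarrow>
      (\<Sum>n. hyp2F1_reg_fps a b c $ n)) (at_left (1::real))"
  proof (rule tannerys_theorem[THEN conjunct2, THEN conjunct2])
    show "((\<lambda>x. hyp2F1_reg_fps a b c $ n * of_real x ^ n) \<longlongrightarrow> hyp2F1_reg_fps a b c $ n)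
        (at_left (1::real))" for n
      by (rule tendsto_eq_intros refl)+ simp
    have ev: "eventually (\<lambda>x. x \<in> {0<..<1}) (at_left (1::real))"
      by (intro eventually_at_left_real) auto
    have "norm (hyp2F1_reg_fps a b c $ n * of_real x ^ n) \<le> norm (hyp2F1_reg_fps a b c $ n)"
      if "x \<in> {0<..<1}" for n and x :: real
      using that by (auto simp: norm_mult norm_power intro!: mult_left_le power_le_one)
    thus "eventually (\<lambda>(n, x). norm (hyp2F1_reg_fps a b c $ n * of_real x ^ n) \<le>
        norm (hyp2F1_reg_fps a b c $ n)) (at_top \<times>\<^sub>F at_left (1::real))"
      unfolding eventually_prod_filter using ev
      by (intro exI[of _ "\<lambda>_. True"] exI[of _ "\<lambda>x. x \<in> {0<..<1}"]) auto
  qed (auto intro: summable_hyp2F1_reg_fps)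
  moreover have "eventually (\<lambda>x. (\<Sum>n. hyp2F1_reg_fps a b c $ n * of_real x ^ n) =
      hyp2F1_reg a b c (of_real x)) (at_left (1::real))"
    using eventually_at_left_real[of 0 "1::real"]
    by (rule eventually_mono) (auto simp: hyp2F1_reg_sums)
  ultimately show ?thesis by (rule Lim_transform_eventually)
qed

end

text \<open>Gauss's recurrence in c: termwise, the difference of the two sides telescopes with
  \<open>u\<close> n = n times the n-th coefficient.\<close>

lemma suminf_hyp2F1_reg_fps_Suc:
  assumes c: "c \<notin> \<int>\<^sub>\<le>\<^sub>0" and Re_pos: "Re (c - a - b) > 0"
  shows "(c - a - b) * (\<Sum>n. hyp2F1_reg_fps a b c $ n) =
           (c - a) * (c - b) * (\<Sum>n. hyp2F1_reg_fps a b (c + 1) $ n)"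
proof -
  have c1: "c + 1 \<notin> \<int>\<^sub>\<le>\<^sub>0" using c plus_one_in_nonpos_Ints_imp by blast
  define u where "u n = of_nat n * hyp2F1_reg_fps a b c $ n" for n
  have u: "u \<longlonglongrightarrow> 0" unfolding u_def
    by (rule hyp2F1_reg_fps_nth_mult_tendsto_0[OF assms])
  have "(\<lambda>n. u n - u (Suc n)) sums (u 0 - 0)"
    by (rule telescope_sums'[OF u])
  moreover have "u n - u (Suc n) = (c - a - b) * hyp2F1_reg_fps a b c $ n -
      (c - a) * (c - b) * hyp2F1_reg_fps a b (c + 1) $ n" for n
  proof -
    define t where "t = pochhammer a n * pochhammer b n * rGamma (c + 1 + of_nat n) / fact n"
    have 1: "hyp2F1_reg_fps a b (c + 1) $ n = t"
      by (simp add: hyp2F1_reg_fps_def t_def)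
    have 2: "hyp2F1_reg_fps a b c $ n = (c + of_nat n) * t"
      using rGamma_rec[of "c + of_nat n"] by (simp add: hyp2F1_reg_fps_def t_def add_ac)
    have 3: "u (Suc n) = (a + of_nat n) * (b + of_nat n) * t"
      by (simp add: u_def hyp2F1_reg_fps_def t_def pochhammer_Suc add_ac del: of_nat_Suc)
         (simp add: add_ac)
    show ?thesis unfolding 1 3 unfolding u_def 2 by algebra
  qed
  ultimately have "(\<lambda>n. (c - a - b) * hyp2F1_reg_fps a b c $ n -
      (c - a) * (c - b) * hyp2F1_reg_fps a b (c + 1) $ n) sums 0"
    by (simp add: u_def)
  moreover have "(\<lambda>n. (c - a - b) * hyp2F1_reg_fps a b c $ n -
      (c - a) * (c - b) * hyp2F1_reg_fps a b (c + 1) $ n) sums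
     ((c - a - b) * (\<Sum>n. hyp2F1_reg_fps a b c $ n) -
           (c - a) * (c - b) * (\<Sum>n. hyp2F1_reg_fps a b (c + 1) $ n))"
    using assms c1
    by (intro sums_diff sums_mult summable_sums summable_norm_cancel[OF summable_hyp2F1_reg_fps]) auto
  ultimately show ?thesis using sums_unique2 by fastforce
qed

lemma plus_of_nat_notin_nonpos_Ints: "c \<notin> \<int>\<^sub>\<le>\<^sub>0 \<Longrightarrow> c + of_nat N \<notin> \<int>\<^sub>\<le>\<^sub>0" for c :: complex
proof (induction N)
  case (Suc N)
  thus ?case using plus_one_in_nonpos_Ints_imp[of "c + of_nat N"] by (auto simp: add_ac)
qed simp

lemma suminf_hyp2F1_reg_fps_shift:
  assumes c: "c \<notin> \<int>\<^sub>\<le>\<^sub>0" and Re_pos: "Re (c - a - b) > 0"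
  shows "pochhammer (c - a - b) N * (\<Sum>n. hyp2F1_reg_fps a b c $ n) =
    pochhammer (c - a) N * pochhammer (c - b) N * (\<Sum>n. hyp2F1_reg_fps a b (c + of_nat N) $ n)"
proof (induction N)
  case (Suc N)
  have cN: "c + of_nat N \<notin> \<int>\<^sub>\<le>\<^sub>0"
    using c by (rule plus_of_nat_notin_nonpos_Ints)
  define S where "S M = (\<Sum>n. hyp2F1_reg_fps a b (c + of_nat M) $ n)" for M
  have "(c - a - b + of_nat N) * S N = (c - a + of_nat N) * (c - b + of_nat N) * S (Suc N)"
    using suminf_hyp2F1_reg_fps_Suc[OF cN, of a b] Re_pos by (simp add: S_def algebra_simps)
  with Suc show ?case unfolding pochhammer_Suc S_def [symmetric] by algebra
qed simp

text \<open>After normalizing the constant term to 1, every other term has denominators that grow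
  with N, and Tannery's theorem leaves only the constant term.\<close>

lemma suminf_hyp2F1_reg_fps_limit:
  fixes a b c :: complex
  assumes c: "c \<notin> \<int>\<^sub>\<le>\<^sub>0"
  shows "(\<lambda>N. Gamma (c + of_nat N) * (\<Sum>n. hyp2F1_reg_fps a b (c + of_nat N) $ n)) \<longlonglongrightarrow> 1"
proof -
  define t where "t k N = pochhammer a k * pochhammer b k / fact k *
      (\<Prod>i<k. inverse (c + of_nat N + of_nat i))" for k N
  have cN: "c + of_nat N \<notin> \<int>\<^sub>\<le>\<^sub>0" for N
    using c by (rule plus_of_nat_notin_nonpos_Ints)
  have t: "Gamma (c + of_nat N) * hyp2F1_reg_fps a b (c + of_nat N) $ k = t k N" for k N
  proof -
    have nz: "pochhammer (c + of_nat N) k \<noteq> 0" "rGamma (c + of_nat N) \<noteq> 0"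
      using cN[of N] by (auto simp: pochhammer_eq_0_iff rGamma_eq_zero_iff)
    have "(\<Prod>i<k. inverse (c + of_nat N + of_nat i)) = inverse (pochhammer (c + of_nat N) k)"
      by (simp add: pochhammer_prod prod_inversef [symmetric] o_def atLeast0LessThan)
    also have "\<dots> = Gamma (c + of_nat N) * rGamma (c + of_nat N + of_nat k)"
      using pochhammer_rGamma[of "c + of_nat N" k] nz
      by (simp add: Gamma_def field_simps)
    finally show ?thesis by (simp add: t_def hyp2F1_reg_fps_def)
  qed
  \<comment> \<open>\<open>N0\<close> serves two purposes: Re (c + N0) > 0 makes the moduli of the
    denominators increase from there on, and Re (c + N0 - a - b) > 0 makes the dominating series,
    the one at \<open>N0\<close>, summable.\<close>
  obtain N0 :: nat where N0: "real N0 > \<bar>Re c\<bar> + \<bar>Re (a + b)\<bar>"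
    using reals_Archimedean2 by blast
  have "(\<lambda>N. \<Sum>k. t k N) \<longlonglongrightarrow> (\<Sum>k. pochhammer a k * pochhammer b k / fact k * 0 ^ k)"
  proof (rule tannerys_theorem[THEN conjunct2, THEN conjunct2])
    show "(\<lambda>N. t k N) \<longlonglongrightarrow> pochhammer a k * pochhammer b k / fact k * 0 ^ k" for k
    proof -
      have "(\<lambda>N. inverse (c + of_nat N + of_nat i)) \<longlonglongrightarrow> 0" for i
      proof -
        have "filterlim (\<lambda>N. (c + of_nat i) + of_nat N) at_infinity sequentially"
          by (rule tendsto_add_filterlim_at_infinity[OF tendsto_const tendsto_of_nat])
        hence "(\<lambda>N. inverse ((c + of_nat i) + of_nat N)) \<longlonglongrightarrow> 0"
          by (rule filterlim_compose[OF tendsto_inverse_0])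
        thus ?thesis by (simp add: add_ac)
      qed
      hence "(\<lambda>N. \<Prod>i<k. inverse (c + of_nat N + of_nat i)) \<longlonglongrightarrow> (\<Prod>i<k. 0)"
        by (rule tendsto_prod)
      hence "(\<lambda>N. \<Prod>i<k. inverse (c + of_nat N + of_nat i)) \<longlonglongrightarrow> 0 ^ k"
        by simp
      thus ?thesis unfolding t_def by (rule tendsto_mult[OF tendsto_const])
    qed
    have "norm (t k N) \<le> norm (t k N0)" if "N \<ge> N0" for k N
    proof -
      have "norm (\<Prod>i<k. inverse (c + of_nat N + of_nat i)) \<le>
            norm (\<Prod>i<k. inverse (c + of_nat N0 + of_nat i))"
        unfolding prod_norm [symmetric]
      proof (rule prod_mono, rule conjI)
        fix i assume "i \<in> {..<k}"
        have "norm (c + of_nat N0 + of_nat i) \<le> norm (c + of_nat N + of_nat i)"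
          unfolding cmod_def using N0 that
          by (intro real_sqrt_le_mono add_mono) (auto intro!: power_mono)
        moreover have "0 < norm (c + of_nat N0 + of_nat i)"
        proof -
          have "Re (c + of_nat N0 + of_nat i) > 0" using N0 by simp
          thus ?thesis by (auto simp: complex_eq_iff)
        qed
        ultimately show "norm (inverse (c + of_nat N + of_nat i)) \<le>
            norm (inverse (c + of_nat N0 + of_nat i))"
          by (simp add: norm_inverse le_imp_inverse_le)
      qed simp
      thus ?thesis unfolding t_def norm_mult by (intro mult_left_mono) auto
    qed
    thus "eventually (\<lambda>(k, N). norm (t k N) \<le> norm (t k N0)) (at_top \<times>\<^sub>F at_top)"
      unfolding eventually_prod_filter
      by (intro exI[of _ "\<lambda>_. True"] exI[of _ "\<lambda>N. N \<ge> N0"]) (auto simp: eventually_ge_at_top)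
    have "Re (c + of_nat N0 - a - b) > 0" using N0 by simp
    thus "summable (\<lambda>k. norm (t k N0))"
      by (simp only: t [symmetric] norm_mult summable_mult summable_hyp2F1_reg_fps[OF cN])
  qed simp
  also have "(\<Sum>k. pochhammer a k * pochhammer b k / fact k * 0 ^ k) = 1"
    by (simp only: powser_zero) simp
  finally have "(\<lambda>N. \<Sum>k. t k N) \<longlonglongrightarrow> 1" .
  hence *: "(\<lambda>N. \<Sum>k. Gamma (c + of_nat N) * hyp2F1_reg_fps a b (c + of_nat N) $ k) \<longlonglongrightarrow> 1"
    by (simp only: t)
  have "eventually (\<lambda>N. (\<Sum>k. Gamma (c + of_nat N) * hyp2F1_reg_fps a b (c + of_nat N) $ k) =
      Gamma (c + of_nat N) * (\<Sum>k. hyp2F1_reg_fps a b (c + of_nat N) $ k)) sequentially"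
    using eventually_ge_at_top[of N0]
  proof eventually_elim
    case (elim N)
    have "Re (c + of_nat N - a - b) > 0" using N0 elim by simp
    from summable_norm_cancel[OF summable_hyp2F1_reg_fps[OF cN this]]
    show ?case by (rule suminf_mult)
  qed
  with * show ?thesis by (rule Lim_transform_eventually)
qed

text \<open>The recurrence, iterated n + 1 times, is rewritten with Euler's limits for 1 / Gamma.
  Factorials and powers of n cancel because (c - a - b) + c = (c - a) + (c - b), and letting n tend
  to infinity leaves the Gamma quotient.\<close>

theorem gauss_summation:
  assumes c: "c \<notin> \<int>\<^sub>\<le>\<^sub>0" and Re_pos: "Re (c - a - b) > 0"
  shows "(\<Sum>n. hyp2F1_reg_fps a b c $ n) = Gamma (c - a - b) * rGamma (c - a) * rGamma (c - b)"
proof -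
  define S where "S = (\<Sum>n. hyp2F1_reg_fps a b c $ n)"
  define \<sigma> where "\<sigma> N = Gamma (c + of_nat N) * (\<Sum>n. hyp2F1_reg_fps a b (c + of_nat N) $ n)" for N
  have rc: "rGamma c \<noteq> 0" using c by (simp add: rGamma_eq_zero_iff)
  have eq: "S * rGamma_series (c - a - b) n * rGamma_series c n =
    rGamma_series (c - a) n * rGamma_series (c - b) n * rGamma c * \<sigma> (Suc n)" for n
  proof -
    define N where "N = Suc n"
    define L where "L = complex_of_real (ln (of_nat n))"
    have cN: "c + of_nat N \<notin> \<int>\<^sub>\<le>\<^sub>0"
      using c by (rule plus_of_nat_notin_nonpos_Ints)
    hence sum: "(\<Sum>n. hyp2F1_reg_fps a b (c + of_nat N) $ n) = rGamma (c + of_nat N) * \<sigma> N"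
      by (simp add: \<sigma>_def rGamma_inverse_Gamma Gamma_eq_zero_iff)
    have rGamma_c: "rGamma c = pochhammer c N * rGamma (c + of_nat N)"
      by (rule pochhammer_rGamma)
    have "S * (pochhammer (c - a - b) N * pochhammer c N) =
        (pochhammer (c - a - b) N * S) * pochhammer c N"
      by (simp only: mult_ac)
    also have "pochhammer (c - a - b) N * S =
        pochhammer (c - a) N * pochhammer (c - b) N * (rGamma (c + of_nat N) * \<sigma> N)"
      unfolding S_def sum [symmetric] by (rule suminf_hyp2F1_reg_fps_shift[OF assms])
    also have "\<dots> * pochhammer c N =
        pochhammer (c - a) N * pochhammer (c - b) N * rGamma c * \<sigma> N"
      unfolding rGamma_c by (simp only: mult_ac)
    finally have "S * (pochhammer (c - a - b) N * pochhammer c N) =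
        pochhammer (c - a) N * pochhammer (c - b) N * rGamma c * \<sigma> N" .
    moreover have "pochhammer (c - a - b) N * pochhammer c N =
       rGamma_series (c - a - b) n * rGamma_series c n *
         ((fact n)\<^sup>2 * exp ((c - a) * L) * exp ((c - b) * L))"
    proof -
      have "exp ((c - a - b) * L) * exp (c * L) = exp ((c - a) * L) * exp ((c - b) * L)"
        by (simp add: exp_add [symmetric] algebra_simps)
      moreover have "pochhammer (c - a - b) N * pochhammer c N =
         rGamma_series (c - a - b) n * rGamma_series c n *
           ((fact n)\<^sup>2 * (exp ((c - a - b) * L) * exp (c * L)))"
        unfolding N_def pochhammer_rGamma_series L_def [symmetric]
        by (simp only: power2_eq_square mult_ac)
      ultimately show ?thesis by (simp only: mult.assoc)
    qed
    moreover have "pochhammer (c - a) N * pochhammer (c - b) N =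
       rGamma_series (c - a) n * rGamma_series (c - b) n *
         ((fact n)\<^sup>2 * exp ((c - a) * L) * exp ((c - b) * L))"
      unfolding N_def pochhammer_rGamma_series L_def [symmetric]
      by (simp only: power2_eq_square mult_ac)
    ultimately have "((fact n)\<^sup>2 * exp ((c - a) * L) * exp ((c - b) * L)) *
         (S * rGamma_series (c - a - b) n * rGamma_series c n) =
       ((fact n)\<^sup>2 * exp ((c - a) * L) * exp ((c - b) * L)) *
         (rGamma_series (c - a) n * rGamma_series (c - b) n * rGamma c * \<sigma> N)"
      by (simp only: mult_ac)
    thus ?thesis unfolding N_def by simp
  qed
  have lim1: "(\<lambda>n. S * rGamma_series (c - a - b) n * rGamma_series c n) \<longlonglongrightarrow>
      S * rGamma (c - a - b) * rGamma c"
    by (intro tendsto_intros)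
  have "\<sigma> \<longlonglongrightarrow> 1"
    unfolding \<sigma>_def by (rule suminf_hyp2F1_reg_fps_limit[OF c])
  hence "(\<lambda>n. \<sigma> (Suc n)) \<longlonglongrightarrow> 1" by (rule LIMSEQ_Suc)
  hence lim2: "(\<lambda>n. rGamma_series (c - a) n * rGamma_series (c - b) n * rGamma c * \<sigma> (Suc n)) \<longlonglongrightarrow>
      rGamma (c - a) * rGamma (c - b) * rGamma c * 1"
    by (intro tendsto_intros)
  have "S * rGamma (c - a - b) * rGamma c = rGamma (c - a) * rGamma (c - b) * rGamma c * 1"
    by (rule LIMSEQ_unique[OF lim1[unfolded eq] lim2])
  hence S: "S * rGamma (c - a - b) = rGamma (c - a) * rGamma (c - b)"
    using rc by simp
  have "c - a - b \<notin> \<int>\<^sub>\<le>\<^sub>0"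
  proof
    assume "c - a - b \<in> \<int>\<^sub>\<le>\<^sub>0"
    then obtain m where "c - a - b = of_int m" "m \<le> 0" by (rule nonpos_Ints_cases)
    hence "Re (c - a - b) \<le> 0" by (simp del: minus_complex.sel)
    with Re_pos show False by linarith
  qed
  hence nz: "rGamma (c - a - b) \<noteq> 0"
    by (simp add: rGamma_eq_zero_iff)
  have "S = (S * rGamma (c - a - b)) * Gamma (c - a - b)"
    using nz by (simp add: Gamma_def)
  also have "\<dots> = Gamma (c - a - b) * rGamma (c - a) * rGamma (c - b)"
    unfolding S by (simp only: mult_ac)
  finally show ?thesis unfolding S_def .
qed

section \<open>Ladder relations for Legendre functions\<close>

abbreviation legendre_domain :: "complex set" where
  "legendre_domain \<equiv> - complex_of_real ` {..1}"

lemma legendre_domain_iff: "z \<in> legendre_domain \<longleftrightarrow> z - 1 \<notin> \<real>\<^sub>\<le>\<^sub>0"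
  unfolding complex_slot_left_eq by (auto simp: complex_nonpos_Reals_iff)

lemma open_legendre_domain: "open legendre_domain"
proof -
  have "legendre_domain = (\<lambda>w. w - 1) -` (- \<real>\<^sub>\<le>\<^sub>0)"
    by (rule set_eqI) (subst legendre_domain_iff, simp)
  thus ?thesis
    by (auto intro!: continuous_open_vimage continuous_intros)
qed

lemma connected_legendre_domain: "connected legendre_domain"
  by (intro starlike_imp_connected starlike_slotted_complex_plane_left)

lemma of_real_in_legendre_domain: "x > 1 \<Longrightarrow> of_real x \<in> legendre_domain"
  unfolding complex_slot_left_eq by auto

lemma legendre_domainD:
  assumes "z \<in> legendre_domain"
  shows "z - 1 \<notin> \<real>\<^sub>\<le>\<^sub>0" "z + 1 \<notin> \<real>\<^sub>\<le>\<^sub>0" "z \<notin> \<real>\<^sub>\<le>\<^sub>0" "z \<noteq> 0" "z - 1 \<noteq> 0" "z + 1 \<noteq> 0"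
    "(1 - z) / 2 \<in> cut_plane" "1 / z\<^sup>2 \<in> cut_plane"
proof -
  have z: "Im z = 0 \<Longrightarrow> Re z > 1"
    using assms unfolding complex_slot_left_eq by auto
  show 1: "z - 1 \<notin> \<real>\<^sub>\<le>\<^sub>0" and "z + 1 \<notin> \<real>\<^sub>\<le>\<^sub>0" and 3: "z \<notin> \<real>\<^sub>\<le>\<^sub>0"
    using z by (auto simp: complex_nonpos_Reals_iff)
  show nz: "z \<noteq> 0" and "z - 1 \<noteq> 0" and "z + 1 \<noteq> 0"
    using z by (auto simp: complex_eq_iff)
  have "1 - (1 - z) / 2 = (z + 1) / 2" by (simp add: field_simps)
  thus "(1 - z) / 2 \<in> cut_plane"
    unfolding cut_plane_iff using z by (auto simp: complex_nonpos_Reals_iff)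
  show "1 / z\<^sup>2 \<in> cut_plane"
  proof
    assume "1 / z\<^sup>2 \<in> complex_of_real ` {1..}"
    then obtain t where t: "t \<ge> 1" "1 / z\<^sup>2 = of_real t" by auto
    define r where "r = sqrt (1 / t)"
    have "z\<^sup>2 = of_real (1 / t)" using t nz by (auto simp: field_simps)
    also have "1 / t = r\<^sup>2" using t by (simp add: r_def)
    finally have "z = of_real r \<or> z = - of_real r"
      by (simp add: power2_eq_iff)
    moreover have "r \<ge> 0" "r \<le> 1" using t by (auto simp: r_def)
    ultimately show False using z by auto
  qed
qed

text \<open>The associated Legendre function of the first kind. The power of (z + 1) / (z - 1) is
  split into two principal powers, so that crossing (-1, 1) affects only the power of z - 1.\<close>

definition legendre_p :: "complex \<Rightarrow> complex \<Rightarrow> complex \<Rightarrow> complex" where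
  "legendre_p \<nu> \<mu> z = ((z + 1) powr (\<mu> / 2) * (z - 1) powr (- (\<mu> / 2))) *
     hyp2F1_reg (-\<nu>) (\<nu> + 1) (1 - \<mu>) ((1 - z) / 2)"

text \<open>
  With these normalizations the lowering and raising operators in the degree act in the same way
  on both functions, and the connection formula becomes symmetric in the sign of the order.
\<close>
definition legendre_P_hat :: "complex \<Rightarrow> complex \<Rightarrow> complex \<Rightarrow> complex" where
  "legendre_P_hat \<nu> \<mu> z = rGamma (\<nu> + \<mu> + 1) * legendre_p \<nu> \<mu> z"

definition legendre_Q_hat :: "complex \<Rightarrow> complex \<Rightarrow> complex \<Rightarrow> complex" where
  "legendre_Q_hat \<nu> \<mu> z =
     of_real (sqrt pi) * ((z + 1) powr (\<mu> / 2) * (z - 1) powr (\<mu> / 2)) /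
       (2 powr (\<nu> + 1) * z powr (\<nu> + \<mu> + 1)) *
     hyp2F1_reg ((\<nu> + \<mu> + 2) / 2) ((\<nu> + \<mu> + 1) / 2) (\<nu> + 3 / 2) (1 / z\<^sup>2)"

lemma legendre_Q_conv_hat:
  "legendre_Q \<nu> \<mu> z = exp (\<i> * of_real pi * \<mu>) * Gamma (\<nu> + \<mu> + 1) * legendre_Q_hat \<nu> \<mu> z"
  by (simp add: legendre_Q_def legendre_Q_hat_def)

lemma has_field_derivative_powr_plus:
  fixes z k s :: complex
  assumes "z + k \<notin> \<real>\<^sub>\<le>\<^sub>0"
  shows "((\<lambda>z. (z + k) powr s) has_field_derivative s * (z + k) powr s / (z + k)) (at z)"
proof -
  have "z + k \<noteq> 0" using assms by (metis nonpos_Reals_zero_I)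
  moreover have "((\<lambda>z. z + k) has_field_derivative 1) (at z)"
    by (auto intro!: derivative_eq_intros)
  from DERIV_chain2[OF has_field_derivative_powr[OF assms] this]
  have "((\<lambda>z. (z + k) powr s) has_field_derivative s * (z + k) powr (s - 1)) (at z)"
    by simp
  ultimately show ?thesis by (simp add: powr_diff)
qed

lemma hyp2F1_reg_has_field_derivative [derivative_intros]:
  assumes "(f has_field_derivative f') (at z)" "f z \<in> cut_plane"
  shows "((\<lambda>z. hyp2F1_reg a b c (f z)) has_field_derivative deriv (hyp2F1_reg a b c) (f z) * f') (at z)"
proof -
  have "(hyp2F1_reg a b c has_field_derivative deriv (hyp2F1_reg a b c) (f z)) (at (f z))"
    using holomorphic_derivI[OF holomorphic_hyp2F1_reg open_cut_plane assms(2)] .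
  from DERIV_chain2[OF this assms(1)] show ?thesis .
qed

text \<open>The degrees \<nu> and -\<nu> - 1 give the same function, as they only exchange the
  numerator parameters. This makes the raising relation a reflected lowering relation.\<close>

lemma legendre_p_reflect: "legendre_p (-\<nu>) \<mu> = legendre_p (\<nu> - 1) \<mu>"
  by (rule ext) (simp add: legendre_p_def hyp2F1_reg_commute[of \<nu>])

lemma legendre_p_lower:
  assumes z: "z \<in> legendre_domain"
  shows "(legendre_p \<nu> \<mu> has_field_derivative
     (\<nu> * z * legendre_p \<nu> \<mu> z - (\<nu> + \<mu>) * legendre_p (\<nu> - 1) \<mu> z) / ((z - 1) * (z + 1))) (at z)"
proof -
  note D = legendre_domainD[OF z]
  define g where "g = (z + 1) powr (\<mu> / 2) * (z - 1) powr (- (\<mu> / 2))"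
  define F where "F = hyp2F1_reg (-\<nu>) (\<nu> + 1) (1 - \<mu>)"
  define w where "w = (1 - z) / 2"
  define F1 where "F1 = hyp2F1_reg (1 - \<nu>) \<nu> (1 - \<mu>) w"
  have "((\<lambda>z. ((z + 1) powr (\<mu> / 2) * (z + -1) powr (- (\<mu> / 2))) * F ((1 - z) / 2))
     has_field_derivative ((\<mu> / 2 * (z + 1) powr (\<mu> / 2) / (z + 1)) * (z + - 1) powr (- (\<mu> / 2))
        + (- (\<mu> / 2) * (z + - 1) powr (- (\<mu> / 2)) / (z + - 1)) * (z + 1) powr (\<mu> / 2)) * F ((1 - z) / 2)
        + (deriv F ((1 - z) / 2) * (- 1 / 2)) * ((z + 1) powr (\<mu> / 2) * (z + -1) powr (- (\<mu> / 2)))) (at z)"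
    unfolding F_def using D
    by (intro DERIV_mult has_field_derivative_powr_plus hyp2F1_reg_has_field_derivative)
       (auto intro!: derivative_eq_intros)
  hence der: "(legendre_p \<nu> \<mu> has_field_derivative
      g * (\<mu> / 2 * (1 / (z + 1) - 1 / (z - 1)) * F w - deriv F w / 2)) (at z)"
    by (simp add: legendre_p_def [abs_def] F_def g_def w_def algebra_simps)
  \<comment> \<open>The contiguous relation is solved for the derivative; with w = (1 - z)/2 one has
    4 w (1 - w) = -(z - 1)(z + 1).\<close>
  have "(\<nu> + \<mu>) * F1 = (\<nu> + \<mu> - 2 * \<nu> * w) * F w - 2 * (1 - w) * (w * deriv F w)"
    using hyp2F1_reg_legendre_lower[of w \<nu> "1 - \<mu>"] D unfolding F_def F1_def w_def by simp
  moreover have "z = 1 - 2 * w" by (simp add: w_def field_simps)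
  ultimately have "(z - 1) * (z + 1) * deriv F w = -2 * ((\<nu> * z + \<mu>) * F w - (\<nu> + \<mu>) * F1)"
    by algebra
  moreover have "(z - 1) * (z + 1) \<noteq> 0" using D by simp
  ultimately have dF: "deriv F w = -2 * ((\<nu> * z + \<mu>) * F w - (\<nu> + \<mu>) * F1) / ((z - 1) * (z + 1))"
    by (metis nonzero_mult_div_cancel_left)
  have p: "legendre_p \<nu> \<mu> z = g * F w" "legendre_p (\<nu> - 1) \<mu> z = g * F1"
    by (simp_all add: legendre_p_def F_def F1_def g_def w_def)
  \<comment> \<open>The terms \<mu> \<open>F\<close> from the derivative of the powers and from the
    derivative of \<open>F\<close> cancel, leaving \<nu> z.\<close>
  have "g * (\<mu> / 2 * (1 / (z + 1) - 1 / (z - 1)) * F w - deriv F w / 2) =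
     (\<nu> * z * (g * F w) - (\<nu> + \<mu>) * (g * F1)) / ((z - 1) * (z + 1))"
  proof -
    define j where "j = 1 / ((z - 1) * (z + 1))"
    have "1 / (z + 1) - 1 / (z - 1) = (1 * (z - 1) - 1 * (z + 1)) / ((z + 1) * (z - 1))"
      by (rule diff_frac_eq) (use D in auto)
    hence frac: "1 / (z + 1) - 1 / (z - 1) = -2 * j"
      by (simp add: j_def mult.commute)
    have div: "t / ((z - 1) * (z + 1)) = t * j" for t
      by (simp add: j_def)
    show ?thesis unfolding dF frac div
      by (simp add: algebra_simps add_divide_distrib diff_divide_distrib)
  qed
  thus ?thesis using der unfolding p by simp
qed

lemma legendre_p_raise:
  assumes z: "z \<in> legendre_domain"
  shows "(legendre_p (\<nu> - 1) \<mu> has_field_derivative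
     ((\<nu> - \<mu>) * legendre_p \<nu> \<mu> z - \<nu> * z * legendre_p (\<nu> - 1) \<mu> z) / ((z - 1) * (z + 1))) (at z)"
proof -
  have "- (\<nu> + 1) = - \<nu> - 1" by simp
  hence "legendre_p (- \<nu> - 1) \<mu> = legendre_p \<nu> \<mu>"
    using legendre_p_reflect[of "\<nu> + 1" \<mu>] by (simp only: add_diff_cancel)
  thus ?thesis
    using legendre_p_lower[OF z, of "-\<nu>" \<mu>]
    by (simp add: legendre_p_reflect algebra_simps)
qed

lemma legendre_P_hat_lower:
  assumes z: "z \<in> legendre_domain"
  shows "(legendre_P_hat \<nu> \<mu> has_field_derivative
     (\<nu> * z * legendre_P_hat \<nu> \<mu> z - legendre_P_hat (\<nu> - 1) \<mu> z) / ((z - 1) * (z + 1))) (at z)"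
proof -
  have "rGamma (\<nu> + \<mu>) = (\<nu> + \<mu>) * rGamma (\<nu> + \<mu> + 1)" by (rule rGamma_rec)
  thus ?thesis
    using DERIV_cmult[OF legendre_p_lower[OF z, of \<nu> \<mu>], of "rGamma (\<nu> + \<mu> + 1)"]
    by (simp add: legendre_P_hat_def [abs_def] algebra_simps)
qed

text \<open>The coefficient \<nu>^2 - \<mu>^2 is even in \<mu>. Hence functions of orders \<mu> and
  -\<mu> satisfy the same pair of relations and may enter one Casoratian.\<close>

lemma legendre_P_hat_raise:
  assumes z: "z \<in> legendre_domain"
  shows "(legendre_P_hat (\<nu> - 1) \<mu> has_field_derivative
     ((\<nu>\<^sup>2 - \<mu>\<^sup>2) * legendre_P_hat \<nu> \<mu> z - \<nu> * z * legendre_P_hat (\<nu> - 1) \<mu> z) /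
       ((z - 1) * (z + 1))) (at z)"
proof -
  have *: "rGamma (\<nu> + \<mu>) = (\<nu> + \<mu>) * rGamma (\<nu> + \<mu> + 1)" by (rule rGamma_rec)
  have "rGamma (\<nu> + \<mu>) * ((\<nu> - \<mu>) * legendre_p \<nu> \<mu> z - \<nu> * z * legendre_p (\<nu> - 1) \<mu> z) =
      (\<nu>\<^sup>2 - \<mu>\<^sup>2) * (rGamma (\<nu> + \<mu> + 1) * legendre_p \<nu> \<mu> z) -
      \<nu> * z * (rGamma (\<nu> + \<mu>) * legendre_p (\<nu> - 1) \<mu> z)"
    using * by algebra
  hence "rGamma (\<nu> + \<mu>) *
      (((\<nu> - \<mu>) * legendre_p \<nu> \<mu> z - \<nu> * z * legendre_p (\<nu> - 1) \<mu> z) / ((z - 1) * (z + 1))) =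
      ((\<nu>\<^sup>2 - \<mu>\<^sup>2) * (rGamma (\<nu> + \<mu> + 1) * legendre_p \<nu> \<mu> z) -
      \<nu> * z * (rGamma (\<nu> + \<mu>) * legendre_p (\<nu> - 1) \<mu> z)) / ((z - 1) * (z + 1))"
    by (simp only: times_divide_eq_right)
  moreover have "legendre_P_hat (\<nu> - 1) \<mu> = (\<lambda>z. rGamma (\<nu> + \<mu>) * legendre_p (\<nu> - 1) \<mu> z)"
    by (rule ext) (simp add: legendre_P_hat_def add_ac)
  ultimately show ?thesis
    using DERIV_cmult[OF legendre_p_raise[OF z, of \<nu> \<mu>], of "rGamma (\<nu> + \<mu>)"]
    by (simp only: legendre_P_hat_def [of \<nu>])
qed

section \<open>Ladder relations for the function of the second kind\<close>

definition legendre_Q_factor :: "complex \<Rightarrow> complex \<Rightarrow> complex \<Rightarrow> complex" where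
  "legendre_Q_factor \<nu> \<mu> z =
     of_real (sqrt pi) * ((z + 1) powr (\<mu> / 2) * (z - 1) powr (\<mu> / 2)) /
       (2 powr (\<nu> + 1) * z powr (\<nu> + \<mu> + 1))"

lemma legendre_Q_hat_altdef:
  "legendre_Q_hat \<nu> \<mu> z = legendre_Q_factor \<nu> \<mu> z *
     hyp2F1_reg ((\<nu> + \<mu> + 2) / 2) ((\<nu> + \<mu> + 1) / 2) (\<nu> + 3 / 2) (1 / z\<^sup>2)"
  by (simp add: legendre_Q_hat_def legendre_Q_factor_def)

lemma legendre_Q_factor_rec:
  assumes "z \<noteq> 0"
  shows "legendre_Q_factor (\<nu> - 1) \<mu> z = 2 * z * legendre_Q_factor \<nu> \<mu> z"
proof -
  have "2 powr (\<nu> + 1) = 2 powr \<nu> * (2 :: complex)" "z powr (\<nu> + \<mu> + 1) = z powr (\<nu> + \<mu>) * z"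
    using assms by (simp_all add: powr_add)
  thus ?thesis using assms by (simp add: legendre_Q_factor_def)
qed

lemma legendre_Q_factor_has_field_derivative:
  assumes z: "z \<in> legendre_domain"
  shows "(legendre_Q_factor \<nu> \<mu> has_field_derivative
     legendre_Q_factor \<nu> \<mu> z * (\<mu> * z / ((z - 1) * (z + 1)) - (\<nu> + \<mu> + 1) / z)) (at z)"
proof -
  note D = legendre_domainD[OF z]
  have eq: "\<mu> * z / ((z - 1) * (z + 1)) = \<mu> / 2 / (z + 1) + \<mu> / 2 / (z - 1)"
  proof -
    have "\<mu> / 2 / (z + 1) + \<mu> / 2 / (z - 1) = (\<mu> / 2 * (z - 1) + \<mu> / 2 * (z + 1)) / ((z + 1) * (z - 1))"
      by (rule add_frac_eq) (use D in auto)
    also have "\<mu> / 2 * (z - 1) + \<mu> / 2 * (z + 1) = \<mu> * z" by (simp add: field_simps)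
    finally show ?thesis by (simp only: mult_ac)
  qed
  define K where "K = of_real (sqrt pi) / 2 powr (\<nu> + 1)"
  have "((\<lambda>z. K * (((z + 1) powr (\<mu> / 2) * (z + -1) powr (\<mu> / 2)) * (z + 0) powr (- (\<nu> + \<mu> + 1))))
     has_field_derivative
     K * (((\<mu> / 2 * (z + 1) powr (\<mu> / 2) / (z + 1)) * (z + - 1) powr (\<mu> / 2)
        + (\<mu> / 2 * (z + - 1) powr (\<mu> / 2) / (z + - 1)) * (z + 1) powr (\<mu> / 2)) *
          (z + 0) powr (- (\<nu> + \<mu> + 1)) +
        (- (\<nu> + \<mu> + 1) * (z + 0) powr (- (\<nu> + \<mu> + 1)) / (z + 0)) *
          ((z + 1) powr (\<mu> / 2) * (z + -1) powr (\<mu> / 2)))) (at z)"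
    using D by (intro DERIV_mult DERIV_cmult has_field_derivative_powr_plus) auto
  also have "(\<lambda>z. K * (((z + 1) powr (\<mu> / 2) * (z + -1) powr (\<mu> / 2)) *
      (z + 0) powr (- (\<nu> + \<mu> + 1)))) = legendre_Q_factor \<nu> \<mu>"
    by (rule ext) (simp only: legendre_Q_factor_def K_def powr_minus, simp add: field_simps)
  also have "K * (((\<mu> / 2 * (z + 1) powr (\<mu> / 2) / (z + 1)) * (z + - 1) powr (\<mu> / 2)
        + (\<mu> / 2 * (z + - 1) powr (\<mu> / 2) / (z + - 1)) * (z + 1) powr (\<mu> / 2)) *
          (z + 0) powr (- (\<nu> + \<mu> + 1)) +
        (- (\<nu> + \<mu> + 1) * (z + 0) powr (- (\<nu> + \<mu> + 1)) / (z + 0)) *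
          ((z + 1) powr (\<mu> / 2) * (z + -1) powr (\<mu> / 2))) =
     (K * ((z + 1) powr (\<mu> / 2) * (z - 1) powr (\<mu> / 2)) * z powr (- (\<nu> + \<mu> + 1))) *
     (\<mu> / 2 / (z + 1) + \<mu> / 2 / (z - 1) - (\<nu> + \<mu> + 1) / z)"
    by (simp add: algebra_simps diff_divide_distrib add_divide_distrib)
  also have "K * ((z + 1) powr (\<mu> / 2) * (z - 1) powr (\<mu> / 2)) * z powr (- (\<nu> + \<mu> + 1)) =
     legendre_Q_factor \<nu> \<mu> z"
    by (simp only: legendre_Q_factor_def K_def powr_minus, simp add: field_simps)
  finally show ?thesis unfolding eq .
qed

lemma legendre_Q_hat_has_field_derivative:
  fixes z \<nu> \<mu> :: complex
  assumes z: "z \<in> legendre_domain"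
  defines "F \<equiv> hyp2F1_reg ((\<nu> + \<mu> + 2) / 2) ((\<nu> + \<mu> + 1) / 2) (\<nu> + 3 / 2)"
  shows "(legendre_Q_hat \<nu> \<mu> has_field_derivative
     legendre_Q_factor \<nu> \<mu> z *
     ((\<mu> * z / ((z - 1) * (z + 1)) - (\<nu> + \<mu> + 1) / z) * F (1 / z\<^sup>2) -
       2 / z ^ 3 * deriv F (1 / z\<^sup>2))) (at z)"
proof -
  note D = legendre_domainD[OF z]
  have d: "((\<lambda>z. 1 / z\<^sup>2) has_field_derivative (- 2 / z ^ 3)) (at z)"
    using D by (auto intro!: derivative_eq_intros simp: power2_eq_square power3_eq_cube divide_simps)
  have "((\<lambda>z. F (1 / z\<^sup>2)) has_field_derivative deriv F (1 / z\<^sup>2) * (- 2 / z ^ 3)) (at z)"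
    unfolding F_def by (rule hyp2F1_reg_has_field_derivative[OF d D(8)])
  from DERIV_mult[OF legendre_Q_factor_has_field_derivative[OF z, of \<nu> \<mu>] this]
  show ?thesis
    unfolding legendre_Q_hat_altdef [abs_def] F_def [symmetric]
    by (rule DERIV_cong) (simp add: algebra_simps)
qed

lemma legendre_Q_hat_lower:
  fixes z \<nu> \<mu> :: complex
  assumes z: "z \<in> legendre_domain"
  shows "(legendre_Q_hat \<nu> \<mu> has_field_derivative
     (\<nu> * z * legendre_Q_hat \<nu> \<mu> z - legendre_Q_hat (\<nu> - 1) \<mu> z) / ((z - 1) * (z + 1))) (at z)"
proof -
  note D = legendre_domainD[OF z]
  define w where "w = 1 / z\<^sup>2"
  define b where "b = (\<nu> + \<mu> + 1) / 2"
  define F where "F = hyp2F1_reg ((\<nu> + \<mu> + 2) / 2) b (\<nu> + 3 / 2)"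
  define G where "G = hyp2F1_reg b ((\<nu> + \<mu>) / 2) (\<nu> + 1 / 2) w"
  define h where "h = legendre_Q_factor \<nu> \<mu> z"
  have a: "(\<nu> + \<mu>) / 2 + 1 = (\<nu> + \<mu> + 2) / 2" "\<nu> + 1 / 2 + 1 = \<nu> + 3 / 2"
    by (simp_all add: field_simps)
  have "G = hyp2F1_reg ((\<nu> + \<mu>) / 2) b (\<nu> + 1 / 2) w"
    unfolding G_def by (simp only: hyp2F1_reg_commute)
  hence G: "G = (1 - w) * (w * deriv F w) + (\<nu> + 1 / 2 - b * w) * F w"
    unfolding F_def using hyp2F1_reg_lower[of w "(\<nu> + \<mu>) / 2" b "\<nu> + 1 / 2"] D(8)
    unfolding a w_def by simp
  have Q1: "legendre_Q_hat (\<nu> - 1) \<mu> z = 2 * z * h * G"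
    using legendre_Q_factor_rec[OF D(4), of \<nu> \<mu>]
    by (simp add: legendre_Q_hat_altdef h_def G_def b_def w_def add_ac)
  have Q0: "legendre_Q_hat \<nu> \<mu> z = h * F w"
    by (simp add: legendre_Q_hat_altdef h_def F_def b_def w_def)
  have der: "(legendre_Q_hat \<nu> \<mu> has_field_derivative h *
     ((\<mu> * z / ((z - 1) * (z + 1)) - (\<nu> + \<mu> + 1) / z) * F w - 2 / z ^ 3 * deriv F w)) (at z)"
    using legendre_Q_hat_has_field_derivative[OF z, of \<nu> \<mu>]
    unfolding F_def w_def h_def b_def .
  have eq: "(\<mu> * z / ((z - 1) * (z + 1)) - (\<nu> + \<mu> + 1) / z) * F w - 2 / z ^ 3 * deriv F w =
      (\<nu> * z * F w - 2 * z * G) / ((z - 1) * (z + 1))"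
  proof -
    \<comment> \<open>With names for the reciprocals the claim is a polynomial identity modulo z i =
      1 and (z - 1)(z + 1) j = 1, within reach of \<open>algebra\<close>.\<close>
    define i where "i = 1 / z"
    define j where "j = 1 / ((z - 1) * (z + 1))"
    have "z * i = 1" "(z - 1) * (z + 1) * j = 1" using D by (simp_all add: i_def j_def)
    moreover have "w = i\<^sup>2" "2 * b = \<nu> + \<mu> + 1"
      by (simp_all add: w_def i_def b_def power_divide)
    moreover have "2 * G = 2 * ((1 - w) * (w * deriv F w)) + (2 * \<nu> + 1 - 2 * b * w) * F w"
      unfolding G by (simp add: algebra_simps)
    ultimately have "(\<mu> * z * j - (\<nu> + \<mu> + 1) * i) * F w - 2 * i ^ 3 * deriv F w =
        (\<nu> * z * F w - 2 * z * G) * j"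
      by algebra
    thus ?thesis by (simp add: i_def j_def power_divide)
  qed
  show ?thesis
    using der unfolding eq Q0 Q1
    by (simp only: times_divide_eq_right right_diff_distrib mult_ac)
qed

lemma legendre_Q_hat_raise:
  fixes z \<nu> \<mu> :: complex
  assumes z: "z \<in> legendre_domain"
  shows "(legendre_Q_hat (\<nu> - 1) \<mu> has_field_derivative
     ((\<nu>\<^sup>2 - \<mu>\<^sup>2) * legendre_Q_hat \<nu> \<mu> z - \<nu> * z * legendre_Q_hat (\<nu> - 1) \<mu> z) /
       ((z - 1) * (z + 1))) (at z)"
proof -
  note D = legendre_domainD[OF z]
  define w where "w = 1 / z\<^sup>2"
  define b where "b = (\<nu> + \<mu> + 1) / 2"
  define F where "F = hyp2F1_reg ((\<nu> + \<mu> + 2) / 2) b (\<nu> + 3 / 2) w"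
  define G where "G = hyp2F1_reg ((\<nu> + \<mu>) / 2) b (\<nu> + 1 / 2)"
  define h where "h = legendre_Q_factor \<nu> \<mu> z"
  have a: "(\<nu> + \<mu>) / 2 + 1 = (\<nu> + \<mu> + 2) / 2" "\<nu> + 1 / 2 + 1 = \<nu> + 3 / 2"
    by (simp_all add: field_simps)
  have "(\<nu> + \<mu>) / 2 * (\<nu> + 1 / 2 - b) * F = (\<nu> + \<mu>) / 2 * G w - (1 - w) * deriv G w"
    unfolding F_def G_def using hyp2F1_reg_raise[of w "(\<nu> + \<mu>) / 2" "\<nu> + 1 / 2" b] D(8)
    unfolding a w_def by simp
  also have "(\<nu> + \<mu>) / 2 * (\<nu> + 1 / 2 - b) = (\<nu>\<^sup>2 - \<mu>\<^sup>2) / 4"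
    by (simp add: b_def field_simps power2_eq_square)
  finally have F: "(1 - w) * deriv G w = (\<nu> + \<mu>) / 2 * G w - (\<nu>\<^sup>2 - \<mu>\<^sup>2) / 4 * F"
    by (simp only: eq_diff_eq add.commute)
  have fac: "legendre_Q_factor (\<nu> - 1) \<mu> z = 2 * z * h"
    unfolding h_def by (rule legendre_Q_factor_rec[OF D(4)])
  have Q1: "legendre_Q_hat (\<nu> - 1) \<mu> z = legendre_Q_factor (\<nu> - 1) \<mu> z * G w"
    by (simp add: legendre_Q_hat_altdef G_def b_def w_def add_ac hyp2F1_reg_commute[of "(\<mu> + \<nu>) / 2"])
  have Q0: "legendre_Q_hat \<nu> \<mu> z = h * F"
    by (simp add: legendre_Q_hat_altdef h_def F_def b_def w_def)
  have der: "(legendre_Q_hat (\<nu> - 1) \<mu> has_field_derivative legendre_Q_factor (\<nu> - 1) \<mu> z *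
     ((\<mu> * z / ((z - 1) * (z + 1)) - (\<nu> + \<mu>) / z) * G w - 2 / z ^ 3 * deriv G w)) (at z)"
    using legendre_Q_hat_has_field_derivative[OF z, of "\<nu> - 1" \<mu>]
    unfolding G_def w_def b_def
    by (simp add: add_ac hyp2F1_reg_commute[of "(\<mu> + \<nu>) / 2"])
  have eq: "2 * z * ((\<mu> * z / ((z - 1) * (z + 1)) - (\<nu> + \<mu>) / z) * G w - 2 / z ^ 3 * deriv G w) =
      ((\<nu>\<^sup>2 - \<mu>\<^sup>2) * F - \<nu> * z * (2 * z * G w)) / ((z - 1) * (z + 1))"
  proof -
    define i where "i = 1 / z"
    define j where "j = 1 / ((z - 1) * (z + 1))"
    have "z * i = 1" "(z - 1) * (z + 1) * j = 1" using D by (simp_all add: i_def j_def)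
    moreover have "4 * ((1 - i\<^sup>2) * deriv G w) = 2 * (\<nu> + \<mu>) * G w - (\<nu>\<^sup>2 - \<mu>\<^sup>2) * F"
      using F by (simp add: w_def i_def power_divide)
    ultimately have "2 * z * ((\<mu> * z * j - (\<nu> + \<mu>) * i) * G w - 2 * i ^ 3 * deriv G w) =
        ((\<nu>\<^sup>2 - \<mu>\<^sup>2) * F - \<nu> * z * (2 * z * G w)) * j"
      by algebra
    thus ?thesis by (simp add: i_def j_def power_divide)
  qed
  have "legendre_Q_factor (\<nu> - 1) \<mu> z *
     ((\<mu> * z / ((z - 1) * (z + 1)) - (\<nu> + \<mu>) / z) * G w - 2 / z ^ 3 * deriv G w) =
     h * (((\<nu>\<^sup>2 - \<mu>\<^sup>2) * F - \<nu> * z * (2 * z * G w)) / ((z - 1) * (z + 1)))"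
    unfolding eq [symmetric] fac by (simp only: mult_ac)
  also have "\<dots> = ((\<nu>\<^sup>2 - \<mu>\<^sup>2) * legendre_Q_hat \<nu> \<mu> z - \<nu> * z * legendre_Q_hat (\<nu> - 1) \<mu> z) /
       ((z - 1) * (z + 1))"
    unfolding Q0 Q1 fac by (simp only: times_divide_eq_right right_diff_distrib mult_ac)
  finally show ?thesis using der by (simp only:)
qed

text \<open>The Casoratian replaces the Wronskian, so that no second derivatives are needed.\<close>
lemma casoratian_constant:
  fixes y y' x x' :: "complex \<Rightarrow> complex"
  assumes y: "\<And>z. z \<in> legendre_domain \<Longrightarrow>
      (y has_field_derivative (\<nu> * z * y z - y' z) / ((z - 1) * (z + 1))) (at z)"
    and y': "\<And>z. z \<in> legendre_domain \<Longrightarrow>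
      (y' has_field_derivative (k * y z - \<nu> * z * y' z) / ((z - 1) * (z + 1))) (at z)"
    and x: "\<And>z. z \<in> legendre_domain \<Longrightarrow>
      (x has_field_derivative (\<nu> * z * x z - x' z) / ((z - 1) * (z + 1))) (at z)"
    and x': "\<And>z. z \<in> legendre_domain \<Longrightarrow>
      (x' has_field_derivative (k * x z - \<nu> * z * x' z) / ((z - 1) * (z + 1))) (at z)"
  obtains C where "\<And>z. z \<in> legendre_domain \<Longrightarrow> y z * x' z - y' z * x z = C"
proof -
  have "((\<lambda>z. y z * x' z - y' z * x z) has_field_derivative 0) (at z)" if z: "z \<in> legendre_domain" for z
  proof (rule DERIV_cong[OF DERIV_diff[OF DERIV_mult[OF y[OF z] x'[OF z]] DERIV_mult[OF y'[OF z] x[OF z]]]])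
    define j where "j = 1 / ((z - 1) * (z + 1))"
    have div: "t / ((z - 1) * (z + 1)) = t * j" for t
      by (simp add: j_def)
    show "(\<nu> * z * y z - y' z) / ((z - 1) * (z + 1)) * x' z +
        (k * x z - \<nu> * z * x' z) / ((z - 1) * (z + 1)) * y z -
        ((k * y z - \<nu> * z * y' z) / ((z - 1) * (z + 1)) * x z +
        (\<nu> * z * x z - x' z) / ((z - 1) * (z + 1)) * y' z) = 0"
      unfolding div by algebra
  qed
  note der = this
  define W where "W z = y z * x' z - y' z * x z" for z
  have W: "(W has_field_derivative 0) (at z)" if "z \<in> legendre_domain" for z
    unfolding W_def using der[OF that] .
  have "W constant_on legendre_domain"
    by (rule has_field_derivative_0_imp_constant_on[OF W connected_legendre_domain open_legendre_domain])
  then obtain C where "\<And>z. z \<in> legendre_domain \<Longrightarrow> W z = C"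
    unfolding constant_on_def by auto
  thus ?thesis unfolding W_def by (rule that)
qed

section \<open>Casoratians\<close>

lemma of_real_powr_exp: "x > 0 \<Longrightarrow> complex_of_real x powr s = exp (s * of_real (ln x))"
  by (simp add: powr_def Ln_of_real)

lemma hyp2F1_reg_tendsto_0:
  assumes "(f \<longlongrightarrow> 0) F"
  shows "((\<lambda>x. hyp2F1_reg a b c (f x)) \<longlongrightarrow> rGamma c) F"
proof -
  have "continuous_on cut_plane (hyp2F1_reg a b c)"
    by (intro holomorphic_on_imp_continuous_on holomorphic_hyp2F1_reg)
  hence "isCont (hyp2F1_reg a b c) 0"
    using open_cut_plane zero_in_cut_plane continuous_on_eq_continuous_at by blast
  from isCont_tendsto_compose[OF this assms] show ?thesis by (simp add: hyp2F1_reg_0)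
qed

text \<open>P grows like x^\<nu>. The Pfaff transformation moves the argument from minus infinity to
  (x - 1)/(x + 1), which tends to 1 from the left, and there c - a - b = 1 + 2 \<nu> is independent
  of the order.\<close>

lemma legendre_p_at_top:
  assumes \<mu>: "1 - \<mu> \<notin> \<int>\<^sub>\<le>\<^sub>0" and \<nu>: "Re \<nu> > -1/2"
  shows "((\<lambda>x. exp (- \<nu> * of_real (ln x)) * legendre_p \<nu> \<mu> (of_real x)) \<longlongrightarrow>
     exp (- \<nu> * of_real (ln 2)) * (Gamma (1 + 2 * \<nu>) * rGamma (1 + \<nu> - \<mu>) * rGamma (1 + \<nu>))) at_top"
proof -
  define R where "R = hyp2F1_reg (-\<nu>) (-\<nu> - \<mu>) (1 - \<mu>)"
  have "((\<lambda>x. R (of_real x)) \<longlongrightarrow> (Gamma (1 + 2 * \<nu>) * rGamma (1 + \<nu> - \<mu>) * rGamma (1 + \<nu>))) (at_left 1)"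
  proof -
    have Re: "Re (1 - \<mu> - (-\<nu>) - (-\<nu> - \<mu>)) > 0" using \<nu> by simp
    have eqs: "1 - \<mu> - (-\<nu>) - (-\<nu> - \<mu>) = 1 + 2 * \<nu>" "1 - \<mu> - (-\<nu>) = 1 + \<nu> - \<mu>"
      "1 - \<mu> - (-\<nu> - \<mu>) = 1 + \<nu>" by (simp_all add: algebra_simps)
    show ?thesis
      using hyp2F1_reg_at_left_1[OF \<mu> Re] gauss_summation[OF \<mu> Re] unfolding eqs R_def by (simp add: add.commute)
  qed
  moreover have "filterlim (\<lambda>x::real. (x - 1) / (x + 1)) (at_left 1) at_top"
    by real_asymp
  ultimately have lim_R: "((\<lambda>x. R (of_real ((x - 1) / (x + 1)))) \<longlongrightarrow>
      (Gamma (1 + 2 * \<nu>) * rGamma (1 + \<nu> - \<mu>) * rGamma (1 + \<nu>))) at_top"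
    by (rule filterlim_compose)
  \<comment> \<open>All powers are gathered into exponentials of real logarithms, which leaves two
    elementary real limits.\<close>
  have "((\<lambda>x::real. ln (x + 1) - ln (x - 1)) \<longlongrightarrow> 0) at_top"
    by real_asymp
  moreover have "((\<lambda>x::real. ln ((x + 1) / 2) - ln x) \<longlongrightarrow> - ln 2) at_top"
    by (real_asymp simp: ln_div)
  ultimately have "((\<lambda>x. exp (\<mu> / 2 * of_real (ln (x + 1) - ln (x - 1)) +
        \<nu> * of_real (ln ((x + 1) / 2) - ln x)) * R (of_real ((x - 1) / (x + 1)))) \<longlongrightarrow>
      exp (\<mu> / 2 * of_real 0 + \<nu> * of_real (- ln 2)) *
      (Gamma (1 + 2 * \<nu>) * rGamma (1 + \<nu> - \<mu>) * rGamma (1 + \<nu>))) at_top"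
    by (intro tendsto_intros lim_R)
  moreover have "eventually (\<lambda>x. exp (\<mu> / 2 * of_real (ln (x + 1) - ln (x - 1)) +
        \<nu> * of_real (ln ((x + 1) / 2) - ln x)) * R (of_real ((x - 1) / (x + 1))) =
      exp (- \<nu> * of_real (ln x)) * legendre_p \<nu> \<mu> (of_real x)) at_top"
    using eventually_gt_at_top[of 1]
  proof eventually_elim
    case (elim x)
    define w where "w = (1 - complex_of_real x) / 2"
    have "w \<in> cut_plane"
      unfolding w_def using of_real_in_legendre_domain[OF elim] by (rule legendre_domainD)
    from hyp2F1_reg_pfaff[OF \<mu> this, of "-\<nu>" "\<nu> + 1"]
    have "hyp2F1_reg (-\<nu>) (\<nu> + 1) (1 - \<mu>) w =
        (1 - w) powr \<nu> * hyp2F1_reg (-\<nu>) (1 - \<mu> - (\<nu> + 1)) (1 - \<mu>) (w / (w - 1))"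
      by simp
    also have "1 - \<mu> - (\<nu> + 1) = -\<nu> - \<mu>" by simp
    also have "1 - w = of_real ((x + 1) / 2)" by (simp add: w_def field_simps)
    also have "of_real ((x + 1) / 2) powr \<nu> = exp (\<nu> * of_real (ln ((x + 1) / 2)))"
      using elim by (intro of_real_powr_exp) auto
    also have "w / (w - 1) = of_real ((x - 1) / (x + 1))"
    proof -
      have "complex_of_real x + 1 \<noteq> 0"
        using legendre_domainD(6)[OF of_real_in_legendre_domain[OF elim]] .
      moreover from this have "complex_of_real x \<noteq> -1" by (metis add.left_inverse)
      moreover have "w - 1 = - (of_real x + 1) / 2" by (simp add: w_def field_simps)
      ultimately show ?thesis by (simp add: w_def divide_simps) (simp add: algebra_simps)
    qed
    finally have "hyp2F1_reg (-\<nu>) (\<nu> + 1) (1 - \<mu>) w =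
        exp (\<nu> * of_real (ln ((x + 1) / 2))) * R (of_real ((x - 1) / (x + 1)))"
      by (simp only: R_def)
    moreover have "(complex_of_real x + 1) powr (\<mu> / 2) = exp (\<mu> / 2 * of_real (ln (x + 1)))"
      "(complex_of_real x - 1) powr (- (\<mu> / 2)) = exp (- (\<mu> / 2) * of_real (ln (x - 1)))"
      using of_real_powr_exp[of "x + 1" "\<mu> / 2"] of_real_powr_exp[of "x - 1" "- (\<mu> / 2)"] elim
      by simp_all
    ultimately have "legendre_p \<nu> \<mu> (of_real x) = exp (\<mu> / 2 * of_real (ln (x + 1))) *
        exp (- (\<mu> / 2) * of_real (ln (x - 1))) *
        (exp (\<nu> * of_real (ln ((x + 1) / 2))) * R (of_real ((x - 1) / (x + 1))))"
      unfolding legendre_p_def w_def by simp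
    moreover have "exp (\<mu> / 2 * of_real (ln (x + 1) - ln (x - 1)) +
          \<nu> * of_real (ln ((x + 1) / 2) - ln x)) =
        exp (- \<nu> * of_real (ln x)) * (exp (\<mu> / 2 * of_real (ln (x + 1))) *
        exp (- (\<mu> / 2) * of_real (ln (x - 1))) * exp (\<nu> * of_real (ln ((x + 1) / 2))))"
      unfolding exp_add [symmetric] of_real_diff by (rule arg_cong[of _ _ exp]) (simp add: algebra_simps)
    ultimately show ?case by (simp only: mult_ac)
  qed
  ultimately have "((\<lambda>x. exp (- \<nu> * of_real (ln x)) * legendre_p \<nu> \<mu> (of_real x)) \<longlongrightarrow>
      exp (\<mu> / 2 * of_real 0 + \<nu> * of_real (- ln 2)) *
      (Gamma (1 + 2 * \<nu>) * rGamma (1 + \<nu> - \<mu>) * rGamma (1 + \<nu>))) at_top"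
    by (rule Lim_transform_eventually)
  thus ?thesis by simp
qed

lemma legendre_Q_hat_at_top:
  "((\<lambda>x. exp ((\<nu> + 1) * of_real (ln x)) * legendre_Q_hat \<nu> \<mu> (of_real x)) \<longlongrightarrow>
     of_real (sqrt pi) / 2 powr (\<nu> + 1) * rGamma (\<nu> + 3 / 2)) at_top"
proof -
  define R where "R = hyp2F1_reg ((\<nu> + \<mu> + 2) / 2) ((\<nu> + \<mu> + 1) / 2) (\<nu> + 3 / 2)"
  define K where "K = of_real (sqrt pi) / 2 powr (\<nu> + 1)"
  have "((\<lambda>x::real. 1 / x\<^sup>2) \<longlongrightarrow> 0) at_top" by real_asymp
  hence "((\<lambda>x. complex_of_real (1 / x\<^sup>2)) \<longlongrightarrow> of_real 0) at_top" by (rule tendsto_of_real)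
  hence lim_R: "((\<lambda>x. R (of_real (1 / x\<^sup>2))) \<longlongrightarrow> rGamma (\<nu> + 3 / 2)) at_top"
    unfolding R_def by (intro hyp2F1_reg_tendsto_0) simp
  have "((\<lambda>x::real. ln (x + 1) + ln (x - 1) - 2 * ln x) \<longlongrightarrow> 0) at_top"
    by real_asymp
  hence "((\<lambda>x. K * exp (\<mu> / 2 * of_real (ln (x + 1) + ln (x - 1) - 2 * ln x)) *
      R (of_real (1 / x\<^sup>2))) \<longlongrightarrow> K * exp (\<mu> / 2 * of_real 0) * rGamma (\<nu> + 3 / 2)) at_top"
    by (intro tendsto_intros lim_R)
  moreover have "eventually (\<lambda>x. K * exp (\<mu> / 2 * of_real (ln (x + 1) + ln (x - 1) - 2 * ln x)) *
      R (of_real (1 / x\<^sup>2)) = exp ((\<nu> + 1) * of_real (ln x)) * legendre_Q_hat \<nu> \<mu> (of_real x)) at_top"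
    using eventually_gt_at_top[of 1]
  proof eventually_elim
    case (elim x)
    have powrs: "(complex_of_real x + 1) powr (\<mu> / 2) = exp (\<mu> / 2 * of_real (ln (x + 1)))"
      "(complex_of_real x - 1) powr (\<mu> / 2) = exp (\<mu> / 2 * of_real (ln (x - 1)))"
      "complex_of_real x powr (\<nu> + \<mu> + 1) = exp ((\<nu> + \<mu> + 1) * of_real (ln x))"
      using of_real_powr_exp[of "x + 1" "\<mu> / 2"] of_real_powr_exp[of "x - 1" "\<mu> / 2"] elim
        of_real_powr_exp[of x]
      by simp_all
    have "exp (\<mu> / 2 * of_real (ln (x + 1) + ln (x - 1) - 2 * ln x)) =
        exp ((\<nu> + 1) * of_real (ln x)) * (exp (\<mu> / 2 * of_real (ln (x + 1))) *
        exp (\<mu> / 2 * of_real (ln (x - 1))) / exp ((\<nu> + \<mu> + 1) * of_real (ln x)))"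
      unfolding exp_add [symmetric] exp_diff [symmetric] of_real_diff of_real_add of_real_mult
      by (rule arg_cong[of _ _ exp]) (simp add: algebra_simps)
    thus ?case
      unfolding legendre_Q_hat_def powrs K_def R_def by (simp add: mult_ac)
  qed
  ultimately have "((\<lambda>x. exp ((\<nu> + 1) * of_real (ln x)) * legendre_Q_hat \<nu> \<mu> (of_real x)) \<longlongrightarrow>
      K * exp (\<mu> / 2 * of_real 0) * rGamma (\<nu> + 3 / 2)) at_top"
    by (rule Lim_transform_eventually)
  thus ?thesis by (simp add: K_def)
qed

text \<open>In a product of orders \<mu> and -\<mu> the singular powers at z = 1 cancel, so the
  constant is a limit of hypergeometric values at 0. The reflection formula turns 1 / (Gamma (1 -
  \<mu>) Gamma (1 + \<mu>)) into the sine.\<close>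

lemma casoratian_P_P:
  assumes z: "z \<in> legendre_domain"
  shows "legendre_P_hat \<nu> \<mu> z * legendre_P_hat (\<nu> - 1) (-\<mu>) z -
         legendre_P_hat (\<nu> - 1) \<mu> z * legendre_P_hat \<nu> (-\<mu>) z =
         - 2 * sin (of_real pi * \<mu>) / of_real pi * (rGamma (\<nu> + \<mu> + 1) * rGamma (\<nu> - \<mu> + 1))"
proof -
  have raise: "(legendre_P_hat (\<nu> - 1) (-\<mu>) has_field_derivative
       ((\<nu>\<^sup>2 - \<mu>\<^sup>2) * legendre_P_hat \<nu> (-\<mu>) z - \<nu> * z * legendre_P_hat (\<nu> - 1) (-\<mu>) z) /
         ((z - 1) * (z + 1))) (at z)" if "z \<in> legendre_domain" for z
    using legendre_P_hat_raise[OF that, of \<nu> "-\<mu>"] by simp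
  obtain C where C: "\<And>z. z \<in> legendre_domain \<Longrightarrow>
      legendre_P_hat \<nu> \<mu> z * legendre_P_hat (\<nu> - 1) (-\<mu>) z -
      legendre_P_hat (\<nu> - 1) \<mu> z * legendre_P_hat \<nu> (-\<mu>) z = C"
    by (rule casoratian_constant[OF legendre_P_hat_lower legendre_P_hat_raise
          legendre_P_hat_lower raise], assumption+) (rule that)
  define w where "w x = (1 - complex_of_real x) / 2" for x
  define A where "A = rGamma (\<nu> + \<mu> + 1) * rGamma (\<nu> - \<mu>)"
  define B where "B = rGamma (\<nu> + \<mu>) * rGamma (\<nu> - \<mu> + 1)"
  define H where "H x = A * (hyp2F1_reg (-\<nu>) (\<nu> + 1) (1 - \<mu>) (w x) * hyp2F1_reg (1 - \<nu>) \<nu> (1 + \<mu>) (w x)) -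
      B * (hyp2F1_reg (1 - \<nu>) \<nu> (1 - \<mu>) (w x) * hyp2F1_reg (-\<nu>) (\<nu> + 1) (1 + \<mu>) (w x))" for x
  have "((\<lambda>x. w x) \<longlongrightarrow> w 1) (at_right 1)"
    unfolding w_def by (intro tendsto_intros) auto
  moreover have "w 1 = 0" by (simp add: w_def)
  ultimately have w: "(w \<longlongrightarrow> 0) (at_right 1)" by (simp only:)
  have "(H \<longlongrightarrow> A * (rGamma (1 - \<mu>) * rGamma (1 + \<mu>)) - B * (rGamma (1 - \<mu>) * rGamma (1 + \<mu>))) (at_right 1)"
    unfolding H_def by (intro tendsto_intros hyp2F1_reg_tendsto_0 w)
  moreover have "eventually (\<lambda>x. H x = C) (at_right 1)"
    using eventually_at_right_less[of "1::real"]
  proof eventually_elim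
    case (elim x)
    define z where "z = complex_of_real x"
    have z: "z \<in> legendre_domain" unfolding z_def by (rule of_real_in_legendre_domain[OF elim])
    note D = legendre_domainD[OF z]
    have 1: "(z + 1) powr (\<mu> / 2) * (z + 1) powr (- \<mu> / 2) = 1"
      "(z - 1) powr (- (\<mu> / 2)) * (z - 1) powr (- (- \<mu> / 2)) = 1"
      using D by (simp_all flip: powr_add)
    define s where "s \<mu> = (z + 1) powr (\<mu> / 2) * (z - 1) powr (- (\<mu> / 2))" for \<mu>
    have s: "s \<mu> * s (-\<mu>) = 1"
    proof -
      have "s \<mu> * s (-\<mu>) = ((z + 1) powr (\<mu> / 2) * (z + 1) powr (- \<mu> / 2)) *
        ((z - 1) powr (- (\<mu> / 2)) * (z - 1) powr (- (- \<mu> / 2)))"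
        unfolding s_def by (simp only: mult_ac)
      thus ?thesis unfolding 1 by simp
    qed
    have P: "legendre_P_hat a m z = rGamma (a + m + 1) * (s m * hyp2F1_reg (-a) (a + 1) (1 - m) (w x))" for a m
      by (simp add: legendre_P_hat_def legendre_p_def s_def w_def z_def)
    have "C = (s \<mu> * s (-\<mu>)) * H x"
      using C[OF z] unfolding P H_def A_def B_def
      by (simp add: algebra_simps)
    thus ?case by (simp add: s)
  qed
  hence "(H \<longlongrightarrow> C) (at_right 1)" by (rule tendsto_eventually)
  ultimately have "C = (A - B) * (rGamma (1 - \<mu>) * rGamma (1 + \<mu>))"
    using tendsto_unique[of "at_right (1::real)"] by (simp add: left_diff_distrib)
  also have "A - B = - 2 * \<mu> * (rGamma (\<nu> + \<mu> + 1) * rGamma (\<nu> - \<mu> + 1))"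
    unfolding A_def B_def using rGamma_rec[of "\<nu> - \<mu>"] rGamma_rec[of "\<nu> + \<mu>"] by algebra
  also have "\<dots> * (rGamma (1 - \<mu>) * rGamma (1 + \<mu>)) =
      - 2 * (\<mu> * rGamma (1 + \<mu>) * rGamma (1 - \<mu>)) * (rGamma (\<nu> + \<mu> + 1) * rGamma (\<nu> - \<mu> + 1))"
    by (simp only: mult_ac)
  also have "\<mu> * rGamma (1 + \<mu>) * rGamma (1 - \<mu>) = sin (of_real pi * \<mu>) / of_real pi"
    using rGamma_rec[of \<mu>] rGamma_reflection_complex[of \<mu>] by (simp add: add_ac)
  finally show ?thesis using C[OF z] by simp
qed

text \<open>Apart from 1 / Gamma (\<nu> - \<mu> + 1), the leading coefficients at infinity of Q of
  degree \<nu> - 1 and of P of degree \<nu> have product 1: this is Legendre's duplication formula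
  at \<nu> + 1/2.\<close>

lemma legendre_leading_coeffs:
  assumes "Re \<nu> > 1/2"
  shows "of_real (sqrt pi) / 2 powr \<nu> * rGamma (\<nu> + 1 / 2) *
    (exp (- \<nu> * of_real (ln 2)) * (Gamma (1 + 2 * \<nu>) * rGamma (1 + \<nu>))) = (1 :: complex)"
proof -
  have pos: "t \<notin> \<int>\<^sub>\<le>\<^sub>0" if "Re t > 0" for t :: complex
    using that by (auto elim!: nonpos_Ints_cases)
  have n1: "\<nu> + 1 / 2 \<notin> \<int>\<^sub>\<le>\<^sub>0" and n2: "\<nu> + 1 / 2 + 1 / 2 \<notin> \<int>\<^sub>\<le>\<^sub>0"
    using assms by (auto intro!: pos)
  have eqs: "\<nu> + 1 / 2 + 1 / 2 = 1 + \<nu>" "1 - (1 + 2 * \<nu>) = - \<nu> + - \<nu>" "2 * (\<nu> + 1 / 2) = 1 + 2 * \<nu>"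
    by (simp_all add: algebra_simps)
  have "Gamma (\<nu> + 1 / 2) * Gamma (1 + \<nu>) =
      exp ((- \<nu> + - \<nu>) * of_real (ln 2)) * of_real (sqrt pi) * Gamma (1 + 2 * \<nu>)"
    using Gamma_legendre_duplication[OF n1 n2] unfolding eqs .
  also have "exp ((- \<nu> + - \<nu>) * complex_of_real (ln 2)) =
      exp (- \<nu> * of_real (ln 2)) * exp (- \<nu> * of_real (ln 2))"
    unfolding distrib_right by (rule exp_add)
  finally have "of_real (sqrt pi) * exp (- \<nu> * of_real (ln 2)) * exp (- \<nu> * of_real (ln 2)) *
      Gamma (1 + 2 * \<nu>) = Gamma (\<nu> + 1 / 2) * Gamma (1 + \<nu>)"
    by (simp only: mult_ac)
  moreover have "of_real (sqrt pi) / 2 powr \<nu> = of_real (sqrt pi) * exp (- \<nu> * of_real (ln 2))"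
    using of_real_powr_exp[of 2 \<nu>] by (simp add: exp_minus field_simps)
  moreover have "Gamma (\<nu> + 1 / 2) * rGamma (\<nu> + 1 / 2) = 1" "Gamma (1 + \<nu>) * rGamma (1 + \<nu>) = 1"
    using n1 n2 unfolding eqs by (simp_all add: Gamma_def rGamma_eq_zero_iff)
  ultimately show ?thesis by algebra
qed

text \<open>The order \<sigma> of Q is kept apart from that of P so that one Q can be paired with P
  of order \<mu> and of order -\<mu>. The bound on Re \<nu> lets the asymptotics of P apply to
  degree \<nu> - 1 as well.\<close>

lemma casoratian_Q_P:
  assumes z: "z \<in> legendre_domain" and \<mu>: "1 - \<mu> \<notin> \<int>\<^sub>\<le>\<^sub>0" and \<nu>: "Re \<nu> > 1/2" and \<sigma>: "\<sigma>\<^sup>2 = \<mu>\<^sup>2"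
  shows "legendre_Q_hat \<nu> \<sigma> z * legendre_P_hat (\<nu> - 1) \<mu> z -
         legendre_Q_hat (\<nu> - 1) \<sigma> z * legendre_P_hat \<nu> \<mu> z =
         - (rGamma (\<nu> + \<mu> + 1) * rGamma (\<nu> - \<mu> + 1))"
proof -
  have raise: "(legendre_Q_hat (\<nu> - 1) \<sigma> has_field_derivative
       ((\<nu>\<^sup>2 - \<mu>\<^sup>2) * legendre_Q_hat \<nu> \<sigma> z - \<nu> * z * legendre_Q_hat (\<nu> - 1) \<sigma> z) /
         ((z - 1) * (z + 1))) (at z)" if "z \<in> legendre_domain" for z
    using legendre_Q_hat_raise[OF that, of \<nu> \<sigma>] by (simp add: \<sigma>)
  obtain C where C: "\<And>z. z \<in> legendre_domain \<Longrightarrow>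
      legendre_Q_hat \<nu> \<sigma> z * legendre_P_hat (\<nu> - 1) \<mu> z -
         legendre_Q_hat (\<nu> - 1) \<sigma> z * legendre_P_hat \<nu> \<mu> z = C"
    by (rule casoratian_constant[OF legendre_Q_hat_lower raise
          legendre_P_hat_lower legendre_P_hat_raise], assumption+) (rule that)
  define q where "q n x = exp ((n + 1) * of_real (ln x)) * legendre_Q_hat n \<sigma> (of_real x)" for n x
  define p where "p n x = exp (- n * of_real (ln x)) * legendre_p n \<mu> (of_real x)" for n x
  define lq where "lq n = of_real (sqrt pi) / 2 powr (n + 1) * rGamma (n + 3 / 2)" for n :: complex
  define lp where "lp n = exp (- n * of_real (ln 2)) *
      (Gamma (1 + 2 * n) * rGamma (1 + n - \<mu>) * rGamma (1 + n))" for n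
  have q: "(q n \<longlongrightarrow> lq n) at_top" for n
    unfolding q_def lq_def by (rule legendre_Q_hat_at_top)
  have p: "(p n \<longlongrightarrow> lp n) at_top" if "Re n > -1/2" for n
    unfolding p_def lp_def by (rule legendre_p_at_top[OF \<mu> that])
  have "((\<lambda>x::real. 1 / x\<^sup>2) \<longlongrightarrow> 0) at_top" by real_asymp
  hence inv: "((\<lambda>x. complex_of_real (1 / x\<^sup>2)) \<longlongrightarrow> of_real 0) at_top" by (rule tendsto_of_real)
  \<comment> \<open>Degrees \<nu> for Q and \<nu> - 1 for P give a product of order x^(-2), whence
    the factor 1/x^2; with the degrees interchanged the powers cancel, and only that product
    contributes.\<close>
  have lim1: "((\<lambda>x. rGamma (\<nu> + \<mu>) * (of_real (1 / x\<^sup>2) * (q \<nu> x * p (\<nu> - 1) x)) -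
      rGamma (\<nu> + \<mu> + 1) * (q (\<nu> - 1) x * p \<nu> x)) \<longlongrightarrow>
     rGamma (\<nu> + \<mu>) * (of_real 0 * (lq \<nu> * lp (\<nu> - 1))) - rGamma (\<nu> + \<mu> + 1) * (lq (\<nu> - 1) * lp \<nu>)) at_top"
    using \<nu> by (intro tendsto_intros inv p q) auto
  have "eventually (\<lambda>x. rGamma (\<nu> + \<mu>) * (of_real (1 / x\<^sup>2) * (q \<nu> x * p (\<nu> - 1) x)) -
      rGamma (\<nu> + \<mu> + 1) * (q (\<nu> - 1) x * p \<nu> x) = C) at_top"
    using eventually_gt_at_top[of 1]
  proof eventually_elim
    case (elim x)
    define z where "z = complex_of_real x"
    have z: "z \<in> legendre_domain" unfolding z_def by (rule of_real_in_legendre_domain[OF elim])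
    define e where "e t = exp (t * complex_of_real (ln x))" for t
    have e: "e s * e t = e (s + t)" for s t
      by (simp add: e_def algebra_simps exp_add)
    have "e 1 = z" unfolding e_def z_def using elim by (simp add: exp_of_real)
    hence e2: "e 2 = z\<^sup>2" using e[of 1 1] by (simp add: power2_eq_square)
    have z0: "z \<noteq> 0" using legendre_domainD(4)[OF z] .
    have "q \<nu> x * p (\<nu> - 1) x = e 2 * (legendre_Q_hat \<nu> \<sigma> z * legendre_p (\<nu> - 1) \<mu> z)"
    proof -
      have "q \<nu> x * p (\<nu> - 1) x = (e (\<nu> + 1) * e (- (\<nu> - 1))) *
          (legendre_Q_hat \<nu> \<sigma> z * legendre_p (\<nu> - 1) \<mu> z)"
        unfolding q_def p_def e_def z_def by (simp only: mult_ac)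
      thus ?thesis unfolding e by simp
    qed
    hence 1: "of_real (1 / x\<^sup>2) * (q \<nu> x * p (\<nu> - 1) x) = legendre_Q_hat \<nu> \<sigma> z * legendre_p (\<nu> - 1) \<mu> z"
      using z0 unfolding e2 by (simp add: z_def)
    have 2: "q (\<nu> - 1) x * p \<nu> x = legendre_Q_hat (\<nu> - 1) \<sigma> z * legendre_p \<nu> \<mu> z"
    proof -
      have "q (\<nu> - 1) x * p \<nu> x = (e (\<nu> - 1 + 1) * e (- \<nu>)) *
          (legendre_Q_hat (\<nu> - 1) \<sigma> z * legendre_p \<nu> \<mu> z)"
        unfolding q_def p_def e_def z_def by (simp only: mult_ac)
      thus ?thesis unfolding e by (simp add: e_def)
    qed
    show ?case unfolding 1 2 C[OF z, symmetric]
      by (simp add: legendre_P_hat_def algebra_simps)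
  qed
  hence lim2: "((\<lambda>x. rGamma (\<nu> + \<mu>) * (of_real (1 / x\<^sup>2) * (q \<nu> x * p (\<nu> - 1) x)) -
      rGamma (\<nu> + \<mu> + 1) * (q (\<nu> - 1) x * p \<nu> x)) \<longlongrightarrow> C) at_top"
    by (rule tendsto_eventually)
  have "C = rGamma (\<nu> + \<mu>) * (of_real 0 * (lq \<nu> * lp (\<nu> - 1))) -
      rGamma (\<nu> + \<mu> + 1) * (lq (\<nu> - 1) * lp \<nu>)"
    by (rule tendsto_unique[OF trivial_limit_at_top_linorder lim2 lim1])
  also have "lq (\<nu> - 1) * lp \<nu> = rGamma (\<nu> - \<mu> + 1) *
      (of_real (sqrt pi) / 2 powr \<nu> * rGamma (\<nu> + 1 / 2) *
    (exp (- \<nu> * of_real (ln 2)) * (Gamma (1 + 2 * \<nu>) * rGamma (1 + \<nu>))))"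
  proof -
    have "\<nu> - 1 + 1 = \<nu>" "\<nu> - 1 + 3 / 2 = \<nu> + 1 / 2" "1 + \<nu> - \<mu> = \<nu> - \<mu> + 1" by simp_all
    thus ?thesis unfolding lq_def lp_def by (simp only: mult_ac)
  qed
  also have "\<dots> = rGamma (\<nu> - \<mu> + 1)" unfolding legendre_leading_coeffs[OF \<nu>] by simp
  finally show ?thesis using C[OF z] by simp
qed

section \<open>The connection formula and its boundary values\<close>

lemma one_minus_notin_nonpos_Ints:
  fixes \<mu> :: complex
  assumes "\<mu> \<notin> \<int>"
  shows "1 - \<mu> \<notin> \<int>\<^sub>\<le>\<^sub>0" "1 + \<mu> \<notin> \<int>\<^sub>\<le>\<^sub>0"
proof -
  show "1 - \<mu> \<notin> \<int>\<^sub>\<le>\<^sub>0"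
  proof
    assume "1 - \<mu> \<in> \<int>\<^sub>\<le>\<^sub>0"
    then have "1 - (1 - \<mu>) \<in> \<int>" using nonpos_Ints_subset_Ints by (intro Ints_diff) auto
    with assms show False by simp
  qed
  show "1 + \<mu> \<notin> \<int>\<^sub>\<le>\<^sub>0"
  proof
    assume "1 + \<mu> \<in> \<int>\<^sub>\<le>\<^sub>0"
    then have "(1 + \<mu>) - 1 \<in> \<int>" using nonpos_Ints_subset_Ints by (intro Ints_diff) auto
    with assms show False by simp
  qed
qed

text \<open>Cramer's rule: combining the three pairwise Casoratians of Q, P of order \<mu> and P of
  order -\<mu> makes the terms with Q of degree \<nu> - 1 cancel. The bound on Re \<nu> keeps the
  common factor \<open>r\<close> away from the zeros of 1 / Gamma.\<close>

lemma legendre_Q_hat_connection_large: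
  assumes z: "z \<in> legendre_domain" and \<mu>: "\<mu> \<notin> \<int>" and \<nu>: "Re \<nu> > 1/2 + \<bar>Re \<mu>\<bar>"
  shows "legendre_Q_hat \<nu> \<mu> z =
    of_real pi / (2 * sin (of_real pi * \<mu>)) * (legendre_P_hat \<nu> \<mu> z - legendre_P_hat \<nu> (-\<mu>) z)"
proof -
  define r where "r = rGamma (\<nu> + \<mu> + 1) * rGamma (\<nu> - \<mu> + 1)"
  define s where "s = - 2 * sin (of_real pi * \<mu>) / of_real pi"
  have pos: "t \<notin> \<int>\<^sub>\<le>\<^sub>0" if "Re t > 0" for t :: complex
    using that by (auto elim!: nonpos_Ints_cases)
  have "\<nu> + \<mu> + 1 \<notin> \<int>\<^sub>\<le>\<^sub>0" "\<nu> - \<mu> + 1 \<notin> \<int>\<^sub>\<le>\<^sub>0"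
    using \<nu> by (auto intro!: pos)
  hence r: "r \<noteq> 0" by (simp add: r_def rGamma_eq_zero_iff)
  have sin: "sin (of_real pi * \<mu>) \<noteq> 0"
    using \<mu> by (auto simp: sin_eq_0 mult.commute)
  have \<nu>': "Re \<nu> > 1/2" using \<nu> by linarith
  have "legendre_P_hat \<nu> \<mu> z * legendre_P_hat (\<nu> - 1) (-\<mu>) z -
         legendre_P_hat (\<nu> - 1) \<mu> z * legendre_P_hat \<nu> (-\<mu>) z = s * r"
    unfolding s_def r_def by (rule casoratian_P_P[OF z])
  moreover have "legendre_Q_hat \<nu> \<mu> z * legendre_P_hat (\<nu> - 1) \<mu> z -
         legendre_Q_hat (\<nu> - 1) \<mu> z * legendre_P_hat \<nu> \<mu> z = - r"
    unfolding r_def by (rule casoratian_Q_P[OF z _ \<nu>']) (simp_all add: one_minus_notin_nonpos_Ints \<mu>)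
  moreover have "legendre_Q_hat \<nu> \<mu> z * legendre_P_hat (\<nu> - 1) (-\<mu>) z -
         legendre_Q_hat (\<nu> - 1) \<mu> z * legendre_P_hat \<nu> (-\<mu>) z = - r"
    using casoratian_Q_P[OF z _ \<nu>', of "-\<mu>" \<mu>] one_minus_notin_nonpos_Ints[OF \<mu>]
    by (simp add: r_def mult.commute)
  ultimately have "r * (legendre_Q_hat \<nu> \<mu> z * s) =
      r * (- (legendre_P_hat \<nu> \<mu> z - legendre_P_hat \<nu> (-\<mu>) z))"
    by algebra
  hence "legendre_Q_hat \<nu> \<mu> z * s = - (legendre_P_hat \<nu> \<mu> z - legendre_P_hat \<nu> (-\<mu>) z)"
    by (rule mult_left_cancel[OF r, THEN iffD1])
  moreover have "s * (of_real pi / (2 * sin (of_real pi * \<mu>))) = -1"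
    using sin by (simp add: s_def)
  ultimately show ?thesis by algebra
qed

text \<open>An identity on an open set may be differentiated. The lowering relation then isolates
  degree a - 1, with coefficient 1 and the same form for all three functions, so no division by a
  parameter occurs on the way down.\<close>

theorem legendre_Q_hat_connection:
  assumes z: "z \<in> legendre_domain" and \<mu>: "\<mu> \<notin> \<int>"
  shows "legendre_Q_hat \<nu> \<mu> z =
    of_real pi / (2 * sin (of_real pi * \<mu>)) * (legendre_P_hat \<nu> \<mu> z - legendre_P_hat \<nu> (-\<mu>) z)"
proof -
  define K where "K = of_real pi / (2 * sin (of_real pi * \<mu>))"
  obtain N :: nat where N: "real N > 1/2 + \<bar>Re \<mu>\<bar> - Re \<nu>"
    using reals_Archimedean2 by blast
  \<comment> \<open>The induction counts the steps taken down from the large degree \<nu> + N; n = N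
    is the degree wanted.\<close>
  have "\<forall>z\<in>legendre_domain. legendre_Q_hat (\<nu> + of_nat (N - n)) \<mu> z =
     K * (legendre_P_hat (\<nu> + of_nat (N - n)) \<mu> z - legendre_P_hat (\<nu> + of_nat (N - n)) (-\<mu>) z)"
    if "n \<le> N" for n
    using that
  proof (induction n)
    case 0
    show ?case unfolding K_def
      by (intro ballI legendre_Q_hat_connection_large \<mu>) (use N in simp_all)
  next
    case (Suc n)
    define a where "a = \<nu> + of_nat (N - n)"
    have a1: "\<nu> + of_nat (N - Suc n) = a - 1"
      using Suc.prems by (simp add: a_def of_nat_diff)
    have IH: "legendre_Q_hat a \<mu> z = K * (legendre_P_hat a \<mu> z - legendre_P_hat a (-\<mu>) z)"
      if "z \<in> legendre_domain" for z
      using Suc that by (simp add: a_def)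
    show ?case unfolding a1
    proof
      fix z assume z: "z \<in> legendre_domain"
      have "((\<lambda>z. K * (legendre_P_hat a \<mu> z - legendre_P_hat a (-\<mu>) z)) has_field_derivative
          K * ((a * z * legendre_P_hat a \<mu> z - legendre_P_hat (a - 1) \<mu> z) / ((z - 1) * (z + 1)) -
            (a * z * legendre_P_hat a (-\<mu>) z - legendre_P_hat (a - 1) (-\<mu>) z) / ((z - 1) * (z + 1)))) (at z)"
        by (intro DERIV_cmult DERIV_diff legendre_P_hat_lower z)
      hence "(legendre_Q_hat a \<mu> has_field_derivative
          K * ((a * z * legendre_P_hat a \<mu> z - legendre_P_hat (a - 1) \<mu> z) / ((z - 1) * (z + 1)) -
            (a * z * legendre_P_hat a (-\<mu>) z - legendre_P_hat (a - 1) (-\<mu>) z) / ((z - 1) * (z + 1)))) (at z)"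
        by (rule has_field_derivative_transform_within_open[OF _ open_legendre_domain z]) (simp only: IH)
      from DERIV_unique[OF legendre_Q_hat_lower[OF z] this]
      have "(a * z * legendre_Q_hat a \<mu> z - legendre_Q_hat (a - 1) \<mu> z) / ((z - 1) * (z + 1)) =
          (K * ((a * z * legendre_P_hat a \<mu> z - legendre_P_hat (a - 1) \<mu> z) -
            (a * z * legendre_P_hat a (-\<mu>) z - legendre_P_hat (a - 1) (-\<mu>) z))) / ((z - 1) * (z + 1))"
        by (simp only: diff_divide_distrib [symmetric] times_divide_eq_right)
      moreover have "(z - 1) * (z + 1) \<noteq> 0" using legendre_domainD[OF z] by simp
      ultimately have "a * z * legendre_Q_hat a \<mu> z - legendre_Q_hat (a - 1) \<mu> z =
          K * ((a * z * legendre_P_hat a \<mu> z - legendre_P_hat (a - 1) \<mu> z) -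
            (a * z * legendre_P_hat a (-\<mu>) z - legendre_P_hat (a - 1) (-\<mu>) z))"
        by (simp only: divide_cancel_right) simp
      thus "legendre_Q_hat (a - 1) \<mu> z =
          K * (legendre_P_hat (a - 1) \<mu> z - legendre_P_hat (a - 1) (-\<mu>) z)"
        unfolding IH[OF z] by algebra
    qed
  qed
  from this[of N] z show ?thesis by (simp add: K_def)
qed

text \<open>For z in the upper half-plane 1 - z has negative imaginary part, so negating it adds i
  pi to the principal logarithm.\<close>

lemma powr_minus_1_above:
  assumes "Im z > 0"
  shows "(z - 1) powr a = exp (\<i> * of_real pi * a) * (1 - z) powr a"
proof -
  have nz: "1 - z \<noteq> 0" using assms by (auto simp: complex_eq_iff)
  hence "Ln (- (1 - z)) = Ln (1 - z) + \<i> * of_real pi"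
    using assms by (subst Ln_minus) auto
  hence Ln_eq: "Ln (z - 1) = Ln (1 - z) + \<i> * of_real pi" by (simp only: minus_diff_eq)
  have "exp (a * Ln (z - 1)) = exp (\<i> * of_real pi * a) * exp (a * Ln (1 - z))"
    unfolding Ln_eq exp_add [symmetric] by (rule arg_cong[of _ _ exp]) (simp add: algebra_simps)
  thus ?thesis using nz by (simp add: powr_def)
qed

lemma powr_minus_1_below:
  assumes "Im z < 0"
  shows "(z - 1) powr a = exp (- \<i> * of_real pi * a) * (1 - z) powr a"
proof -
  have nz: "1 - z \<noteq> 0" using assms by (auto simp: complex_eq_iff)
  hence "Ln (- (1 - z)) = Ln (1 - z) - \<i> * of_real pi"
    using assms by (subst Ln_minus) auto
  hence Ln_eq: "Ln (z - 1) = Ln (1 - z) - \<i> * of_real pi" by (simp only: minus_diff_eq)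
  have "exp (a * Ln (z - 1)) = exp (- \<i> * of_real pi * a) * exp (a * Ln (1 - z))"
    unfolding Ln_eq exp_add [symmetric] by (rule arg_cong[of _ _ exp]) (simp add: algebra_simps)
  thus ?thesis using nz by (simp add: powr_def)
qed

text \<open>This differs from \<open>legendre_p\<close> by the branch of the power, which is now analytic across (-1, 1).\<close>
definition ferrers_p :: "complex \<Rightarrow> complex \<Rightarrow> complex \<Rightarrow> complex" where
  "ferrers_p \<nu> \<mu> z = (1 + z) powr (\<mu> / 2) * (1 - z) powr (- (\<mu> / 2)) *
     hyp2F1_reg (-\<nu>) (\<nu> + 1) (1 - \<mu>) ((1 - z) / 2)"

lemma legendre_p_above:
  assumes "Im z > 0"
  shows "legendre_p \<nu> \<mu> z = exp (- \<i> * of_real pi * \<mu> / 2) * ferrers_p \<nu> \<mu> z"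
  unfolding legendre_p_def ferrers_p_def powr_minus_1_above[OF assms] by (simp add: add_ac mult_ac)

lemma legendre_p_below:
  assumes "Im z < 0"
  shows "legendre_p \<nu> \<mu> z = exp (\<i> * of_real pi * \<mu> / 2) * ferrers_p \<nu> \<mu> z"
  unfolding legendre_p_def ferrers_p_def powr_minus_1_below[OF assms] by (simp add: add_ac mult_ac)

section \<open>The doubly slit plane and the boundary values on (-1, 1)\<close>

lemma ferrers_domain_iff: "z \<in> ferrers_domain \<longleftrightarrow> 1 - z \<notin> \<real>\<^sub>\<le>\<^sub>0 \<and> 1 + z \<notin> \<real>\<^sub>\<le>\<^sub>0"
  unfolding ferrers_domain_def complex_double_slot_eq by (auto simp: complex_nonpos_Reals_iff)

lemma open_ferrers_domain: "open ferrers_domain"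
proof -
  have eq: "ferrers_domain = (\<lambda>w. 1 - w) -` (- \<real>\<^sub>\<le>\<^sub>0) \<inter> (\<lambda>w. 1 + w) -` (- \<real>\<^sub>\<le>\<^sub>0)"
    by (rule set_eqI) (subst ferrers_domain_iff, simp)
  have op: "open ((\<lambda>w::complex. 1 - w) -` (- \<real>\<^sub>\<le>\<^sub>0))" "open ((\<lambda>w::complex. 1 + w) -` (- \<real>\<^sub>\<le>\<^sub>0))"
    by (auto intro!: continuous_open_vimage continuous_intros)
  show ?thesis unfolding eq by (rule open_Int[OF op])
qed

lemma connected_ferrers_domain: "connected ferrers_domain"
  unfolding ferrers_domain_def
  by (intro starlike_imp_connected starlike_doubly_slotted_complex_plane) simp

lemma of_real_in_ferrers_domain: "x \<in> {-1<..<1} \<Longrightarrow> of_real x \<in> ferrers_domain"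
  unfolding ferrers_domain_def complex_double_slot_eq by auto

lemma ferrers_domain_imp_cut_plane: "z \<in> ferrers_domain \<Longrightarrow> (1 - z) / 2 \<in> cut_plane"
  unfolding ferrers_domain_def complex_double_slot_eq complex_slot_right_eq by auto

lemma holomorphic_ferrers_p: "ferrers_p \<nu> \<mu> holomorphic_on ferrers_domain"
  unfolding ferrers_p_def
  by (intro holomorphic_intros ferrers_domain_imp_cut_plane) (auto simp: ferrers_domain_iff)

lemma islimpt_LIMSEQ:
  fixes x :: "'a :: first_countable_topology"
  assumes "f \<longlonglongrightarrow> x" "\<And>n. f n \<in> S - {x}"
  shows "x islimpt S"
  using assms unfolding islimpt_sequential by blast

text \<open>\<open>Lim\<close> is pinned down by a convergence statement only for a proper filter,
  so real points must be limit points of both half-planes.\<close>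

lemma half_plane_at_neq_bot:
  "at (complex_of_real x) within {z. Im z > 0} \<noteq> bot"
  "at (complex_of_real x) within {z. Im z < 0} \<noteq> bot"
proof -
  have lim: "(\<lambda>n. of_real x + c * of_real (inverse (real (Suc n)))) \<longlonglongrightarrow> complex_of_real x" for c
  proof -
    have "(\<lambda>n. of_real x + c * of_real (inverse (real (Suc n)))) \<longlonglongrightarrow> complex_of_real x + c * of_real 0"
      by (intro tendsto_intros LIMSEQ_inverse_real_of_nat)
    thus ?thesis by simp
  qed
  have "of_real x + \<i> * of_real (inverse (real (Suc n))) \<in> {z. Im z > 0} - {complex_of_real x}" for n
    by (simp add: complex_eq_iff del: of_nat_Suc)
  with lim[of \<i>] have "complex_of_real x islimpt {z. Im z > 0}"
    by (rule islimpt_LIMSEQ)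
  thus "at (complex_of_real x) within {z. Im z > 0} \<noteq> bot"
    by (simp add: trivial_limit_within)
  have "of_real x + - \<i> * of_real (inverse (real (Suc n))) \<in> {z. Im z < 0} - {complex_of_real x}" for n
    by (simp add: complex_eq_iff del: of_nat_Suc)
  with lim[of "- \<i>"] have "complex_of_real x islimpt {z. Im z < 0}"
    by (rule islimpt_LIMSEQ)
  thus "at (complex_of_real x) within {z. Im z < 0} \<noteq> bot"
    by (simp add: trivial_limit_within)
qed

text \<open>The right-hand side of the theorem in regularized form, with powers that are visibly
  holomorphic on the doubly slit plane.\<close>

definition ferrers_combination :: "complex \<Rightarrow> complex \<Rightarrow> complex \<Rightarrow> complex" where
  "ferrers_combination \<nu> \<mu> z = of_real pi / (2 * sin (of_real pi * \<mu>)) *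
     (cos (of_real pi * \<mu>) * ferrers_p \<nu> \<mu> z -
      Gamma (\<nu> + \<mu> + 1) * rGamma (\<nu> - \<mu> + 1) * ferrers_p \<nu> (-\<mu>) z)"

text \<open>Phases decide: in the defining average, P of order \<mu> enters with exp (-i pi \<mu>)
  from above and exp (i pi \<mu>) from below, whose mean is the cosine, while for order -\<mu> all
  phases cancel on both sides.\<close>

lemma ferrers_Q_real_conv_combination:
  assumes \<mu>: "\<mu> \<notin> \<int>" and \<nu>: "\<nu> + \<mu> + 1 \<notin> \<int>\<^sub>\<le>\<^sub>0" and x: "x \<in> {-1<..<1}"
  shows "ferrers_Q_real \<nu> \<mu> x = ferrers_combination \<nu> \<mu> (of_real x)"
proof -
  define K where "K = of_real pi / (2 * sin (of_real pi * \<mu>))"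
  define G where "G = Gamma (\<nu> + \<mu> + 1) * rGamma (\<nu> - \<mu> + 1)"
  define E where "E t = exp (\<i> * of_real pi * \<mu> * t)" for t
  \<comment> \<open>The sign \<open>s\<close> is 1 above the cut and -1 below, so one formula serves
    both sides.\<close>
  define L where "L s z = K * E 1 * (E (- (s / 2)) * ferrers_p \<nu> \<mu> z - G * E (s / 2) * ferrers_p \<nu> (-\<mu>) z)"
    for s z
  have E: "E s * E t = E (s + t)" for s t
    by (simp add: E_def exp_add distrib_left)
  have Gr: "Gamma (\<nu> + \<mu> + 1) * rGamma (\<nu> + \<mu> + 1) = 1"
    using \<nu> by (simp add: Gamma_def rGamma_eq_zero_iff)
  have Q: "legendre_Q \<nu> \<mu> z = L s z"
    if z: "z \<in> legendre_domain" and p: "legendre_p \<nu> \<mu> z = E (- (s / 2)) * ferrers_p \<nu> \<mu> z"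
      "legendre_p \<nu> (-\<mu>) z = E (s / 2) * ferrers_p \<nu> (-\<mu>) z" for s z
  proof -
    have "legendre_Q \<nu> \<mu> z = E 1 * Gamma (\<nu> + \<mu> + 1) *
        (K * (rGamma (\<nu> + \<mu> + 1) * (E (- (s / 2)) * ferrers_p \<nu> \<mu> z) -
          rGamma (\<nu> - \<mu> + 1) * (E (s / 2) * ferrers_p \<nu> (-\<mu>) z)))"
      unfolding legendre_Q_conv_hat legendre_Q_hat_connection[OF z \<mu>] legendre_P_hat_def p
      by (simp add: K_def E_def)
    thus ?thesis using Gr unfolding L_def G_def by algebra
  qed
  have dom: "z \<in> legendre_domain" if "Im z \<noteq> 0" for z
    using that by auto
  have above: "legendre_Q \<nu> \<mu> z = L 1 z" if "Im z > 0" for z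
    using that by (intro Q dom) (simp_all add: legendre_p_above E_def)
  have below: "legendre_Q \<nu> \<mu> z = L (-1) z" if "Im z < 0" for z
    using that by (intro Q dom) (simp_all add: legendre_p_below E_def)
  have "of_real x \<in> ferrers_domain" using x by (rule of_real_in_ferrers_domain)
  hence "isCont (ferrers_p \<nu> \<mu>) (of_real x)" for \<mu>
    using holomorphic_on_imp_continuous_on[OF holomorphic_ferrers_p] open_ferrers_domain
      continuous_on_eq_continuous_at by blast
  hence "(ferrers_p \<nu> \<mu> \<longlongrightarrow> ferrers_p \<nu> \<mu> (of_real x)) (at (of_real x) within A)" for \<mu> A
    by (meson isCont_def tendsto_within_subset subset_UNIV)
  hence L: "(L s \<longlongrightarrow> L s (of_real x)) (at (of_real x) within A)" for s A
    unfolding L_def by (intro tendsto_intros)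
  have "legendre_Q_above \<nu> \<mu> x = L 1 (of_real x)"
    unfolding legendre_Q_above_def
  proof (rule tendsto_Lim[OF half_plane_at_neq_bot(1)])
    have "eventually (\<lambda>z. L 1 z = legendre_Q \<nu> \<mu> z) (at (complex_of_real x) within {z. Im z > 0})"
      by (auto simp: eventually_at_filter above)
    with L show "(legendre_Q \<nu> \<mu> \<longlongrightarrow> L 1 (of_real x)) (at (of_real x) within {z. Im z > 0})"
      by (rule Lim_transform_eventually)
  qed
  moreover have "legendre_Q_below \<nu> \<mu> x = L (-1) (of_real x)"
    unfolding legendre_Q_below_def
  proof (rule tendsto_Lim[OF half_plane_at_neq_bot(2)])
    have "eventually (\<lambda>z. L (-1) z = legendre_Q \<nu> \<mu> z) (at (complex_of_real x) within {z. Im z < 0})"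
      by (auto simp: eventually_at_filter below)
    with L show "(legendre_Q \<nu> \<mu> \<longlongrightarrow> L (-1) (of_real x)) (at (of_real x) within {z. Im z < 0})"
      by (rule Lim_transform_eventually)
  qed
  ultimately have "ferrers_Q_real \<nu> \<mu> x =
      1 / 2 * (E (-1/2) * E (-1) * L 1 (of_real x) + E (1/2) * E (-1) * L (-1) (of_real x))"
    unfolding ferrers_Q_real_def by (simp add: E_def)
  also have "E (-1/2) * E (-1) * L 1 (of_real x) =
      K * (E (-1) * ferrers_p \<nu> \<mu> (of_real x) - G * ferrers_p \<nu> (-\<mu>) (of_real x))"
  proof -
    have "E (-1/2) * E (-1) * L 1 (of_real x) =
        K * ((E (-1/2) * E (-1) * E 1 * E (-1/2)) * ferrers_p \<nu> \<mu> (of_real x) -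
          G * (E (-1/2) * E (-1) * E 1 * E (1/2)) * ferrers_p \<nu> (-\<mu>) (of_real x))"
      by (simp add: L_def algebra_simps)
    also have "E (-1/2) * E (-1) * E 1 * E (-1/2) = E (-1)" unfolding E by simp
    also have "E (-1/2) * E (-1) * E 1 * E (1/2) = 1" unfolding E by (simp add: E_def)
    finally show ?thesis by simp
  qed
  also have "E (1/2) * E (-1) * L (-1) (of_real x) =
      K * (E 1 * ferrers_p \<nu> \<mu> (of_real x) - G * ferrers_p \<nu> (-\<mu>) (of_real x))"
  proof -
    have "E (1/2) * E (-1) * L (-1) (of_real x) =
        K * ((E (1/2) * E (-1) * E 1 * E (1/2)) * ferrers_p \<nu> \<mu> (of_real x) -
          G * (E (1/2) * E (-1) * E 1 * E (-1/2)) * ferrers_p \<nu> (-\<mu>) (of_real x))"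
      by (simp add: L_def algebra_simps)
    also have "E (1/2) * E (-1) * E 1 * E (1/2) = E 1" unfolding E by simp
    also have "E (1/2) * E (-1) * E 1 * E (-1/2) = 1" unfolding E by (simp add: E_def)
    finally show ?thesis by simp
  qed
  also have "1 / 2 * (K * (E (-1) * ferrers_p \<nu> \<mu> (of_real x) - G * ferrers_p \<nu> (-\<mu>) (of_real x)) +
        K * (E 1 * ferrers_p \<nu> \<mu> (of_real x) - G * ferrers_p \<nu> (-\<mu>) (of_real x))) =
      K * ((E 1 + E (-1)) / 2 * ferrers_p \<nu> \<mu> (of_real x) - G * ferrers_p \<nu> (-\<mu>) (of_real x))"
    by (simp add: algebra_simps add_divide_distrib)
  also have "(E 1 + E (-1)) / 2 = cos (of_real pi * \<mu>)"
    by (simp add: cos_exp_eq E_def mult_ac)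
  finally show ?thesis
    by (simp only: ferrers_combination_def K_def G_def)
qed

lemma holomorphic_ferrers_combination: "ferrers_combination \<nu> \<mu> holomorphic_on ferrers_domain"
  unfolding ferrers_combination_def by (intro holomorphic_intros holomorphic_ferrers_p)

lemma ferrers_domain_eqI:
  assumes "f holomorphic_on ferrers_domain" "g holomorphic_on ferrers_domain"
    and "\<And>x. x \<in> {-1<..<1} \<Longrightarrow> f (of_real x) = g (of_real x)"
    and "z \<in> ferrers_domain"
  shows "f z = g z"
proof -
  have lim: "(\<lambda>n. complex_of_real (inverse (real (Suc (Suc n))))) \<longlonglongrightarrow> of_real 0"
    using LIMSEQ_Suc[OF LIMSEQ_inverse_real_of_nat] by (rule tendsto_of_real)
  have "complex_of_real (inverse (real (Suc (Suc n)))) \<in> complex_of_real ` {-1<..<1} - {0}" for n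
  proof -
    have "inverse (real (Suc (Suc n))) \<in> {-1<..<1}" "inverse (real (Suc (Suc n))) \<noteq> 0"
      by (auto simp: field_simps)
    moreover have "complex_of_real r \<in> complex_of_real ` {-1<..<1} - {0}"
      if "r \<in> {-1<..<1}" "r \<noteq> 0" for r using that by simp
    ultimately show ?thesis by blast
  qed
  hence limpt: "0 islimpt complex_of_real ` {-1<..<1}"
    by (rule islimpt_LIMSEQ[OF lim[unfolded of_real_0]])
  have "f z - g z = 0"
  proof (rule analytic_continuation[OF _ open_ferrers_domain connected_ferrers_domain _ _ limpt _ assms(4)])
    show "(\<lambda>z. f z - g z) holomorphic_on ferrers_domain"
      by (intro holomorphic_intros assms)
    show "complex_of_real ` {-1<..<1} \<subseteq> ferrers_domain"
      using of_real_in_ferrers_domain by blast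
    show "0 \<in> ferrers_domain" using of_real_in_ferrers_domain[of 0] by simp
  qed (use assms(3) in auto)
  thus ?thesis by simp
qed

text \<open>The explicit combination also witnesses that an analytic extension exists; without a
  witness the choice in \<open>ferrers_Q\<close> would be unconstrained.\<close>

lemma ferrers_Q_conv_combination:
  assumes \<mu>: "\<mu> \<notin> \<int>" and \<nu>: "\<nu> + \<mu> + 1 \<notin> \<int>\<^sub>\<le>\<^sub>0" and z: "z \<in> ferrers_domain"
  shows "ferrers_Q \<nu> \<mu> z = ferrers_combination \<nu> \<mu> z"
proof -
  have "ferrers_Q \<nu> \<mu> holomorphic_on ferrers_domain \<and>
      (\<forall>x\<in>{-1<..<1}. ferrers_Q \<nu> \<mu> (of_real x) = ferrers_Q_real \<nu> \<mu> x)"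
    unfolding ferrers_Q_def
    by (rule someI[of _ "ferrers_combination \<nu> \<mu>"])
       (simp add: holomorphic_ferrers_combination ferrers_Q_real_conv_combination[OF \<mu> \<nu>])
  thus ?thesis
    by (intro ferrers_domain_eqI[OF _ holomorphic_ferrers_combination _ z])
       (simp_all add: ferrers_Q_real_conv_combination[OF \<mu> \<nu>])
qed

text \<open>Both sides are holomorphic on the doubly slit plane and agree on (-1, 1), where only
  real logarithms occur; this replaces a discussion of arguments.\<close>

lemma powr_moebius:
  assumes z: "z \<in> ferrers_domain"
  shows "((1 + z) / (1 - z)) powr a = (1 + z) powr a * (1 - z) powr (- a)"
proof (rule ferrers_domain_eqI[OF _ _ _ z])
  have "(1 + z) / (1 - z) \<notin> \<real>\<^sub>\<le>\<^sub>0" if z: "z \<in> ferrers_domain" for z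
  proof
    assume "(1 + z) / (1 - z) \<in> \<real>\<^sub>\<le>\<^sub>0"
    then obtain t where t: "t \<le> 0" "(1 + z) / (1 - z) = of_real t"
      by (auto elim!: nonpos_Reals_cases)
    have nz: "1 - z \<noteq> 0" using z unfolding ferrers_domain_iff by auto
    hence eq: "1 + z = of_real t * (1 - z)" using t by (simp add: field_simps)
    hence "z * (1 + of_real t) = of_real (t - 1)" by (simp add: algebra_simps)
    \<comment> \<open>The value t = -1 of the quotient belongs to z = infinity. Any other t \<le> 0
      comes from z = (t - 1)/(t + 1), a point of one of the two cuts.\<close>
    moreover have t1: "1 + t \<noteq> 0"
    proof
      assume "1 + t = 0"
      hence "t = -1" by simp
      with eq show False by (simp add: algebra_simps)
    qed
    hence "1 + complex_of_real t \<noteq> 0"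
      by (metis of_real_1 of_real_add of_real_eq_0_iff)
    ultimately have z': "z = of_real ((t - 1) / (1 + t))"
      by (simp add: eq_divide_eq)
    have "(t - 1) / (1 + t) \<le> -1 \<or> (t - 1) / (1 + t) \<ge> 1"
      using t t1 by (cases "1 + t > 0") (auto simp: field_simps)
    thus False using z unfolding z' ferrers_domain_def complex_double_slot_eq by auto
  qed
  thus "(\<lambda>z. ((1 + z) / (1 - z)) powr a) holomorphic_on ferrers_domain"
    by (intro holomorphic_intros) (auto simp: ferrers_domain_iff)
  show "(\<lambda>z. (1 + z) powr a * (1 - z) powr (- a)) holomorphic_on ferrers_domain"
    by (intro holomorphic_intros) (auto simp: ferrers_domain_iff)
next
  fix x :: real assume x: "x \<in> {-1<..<1}"
  have "((1 + complex_of_real x) / (1 - of_real x)) = of_real ((1 + x) / (1 - x))" by simp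
  also have "\<dots> powr a = exp (a * of_real (ln ((1 + x) / (1 - x))))"
    using x by (intro of_real_powr_exp) auto
  also have "ln ((1 + x) / (1 - x)) = ln (1 + x) - ln (1 - x)"
    using x by (simp add: ln_div)
  also have "exp (a * of_real (ln (1 + x) - ln (1 - x))) =
      exp (a * of_real (ln (1 + x))) * exp (- a * of_real (ln (1 - x)))"
    by (simp add: exp_add [symmetric] algebra_simps)
  also have "\<dots> = (of_real (1 + x)) powr a * (of_real (1 - x)) powr (- a)"
    using of_real_powr_exp[of "1 + x" a] of_real_powr_exp[of "1 - x" "- a"] x by simp
  finally show "((1 + complex_of_real x) / (1 - of_real x)) powr a =
      (1 + of_real x) powr a * (1 - of_real x) powr (- a)" by simp
qed

theorem theorem3p1:
  fixes x \<nu> \<mu> :: complex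
  assumes "x \<in> ferrers_domain"
    and "\<mu> \<notin> \<int>"
    and "\<forall>n::nat. n \<ge> 1 \<longrightarrow> \<nu> + \<mu> \<noteq> - of_nat n"
  shows "ferrers_Q \<nu> \<mu> x =
    of_real pi / (2 * sin (of_real pi * \<mu>)) *
    (cos (of_real pi * \<mu>) * rGamma (1 - \<mu>) * ((1 + x) / (1 - x)) powr (\<mu> / 2) *
       hyp2F1 (- \<nu>) (\<nu> + 1) (1 - \<mu>) ((1 - x) / 2)
     - Gamma (\<nu> + \<mu> + 1) * (rGamma (\<mu> + 1) * rGamma (\<nu> - \<mu> + 1)) *
       ((1 - x) / (1 + x)) powr (\<mu> / 2) *
       hyp2F1 (- \<nu>) (\<nu> + 1) (1 + \<mu>) ((1 - x) / 2))"
proof -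
  have \<nu>: "\<nu> + \<mu> + 1 \<notin> \<int>\<^sub>\<le>\<^sub>0"
  proof
    assume "\<nu> + \<mu> + 1 \<in> \<int>\<^sub>\<le>\<^sub>0"
    then obtain n where "\<nu> + \<mu> + 1 = - of_nat n" by (elim nonpos_Ints_cases')
    moreover have "\<nu> + \<mu> = (\<nu> + \<mu> + 1) - 1" by simp
    ultimately have "\<nu> + \<mu> = - of_nat (Suc n)" by simp
    with assms(3) show False by (metis le_add1 plus_1_eq_Suc)
  qed
  have w: "(1 - x) / 2 \<in> cut_plane" using assms(1) by (rule ferrers_domain_imp_cut_plane)
  \<comment> \<open>The domain is symmetric under negation, so the second power is the first one at
    -x.\<close>
  have "- x \<in> ferrers_domain" using assms(1) by (simp add: ferrers_domain_iff)
  from powr_moebius[OF this, of "\<mu> / 2"]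
  have pow2: "((1 - x) / (1 + x)) powr (\<mu> / 2) = (1 - x) powr (\<mu> / 2) * (1 + x) powr (- (\<mu> / 2))"
    by simp
  have p1: "ferrers_p \<nu> \<mu> x = rGamma (1 - \<mu>) * ((1 + x) / (1 - x)) powr (\<mu> / 2) *
       hyp2F1 (- \<nu>) (\<nu> + 1) (1 - \<mu>) ((1 - x) / 2)"
    unfolding ferrers_p_def powr_moebius[OF assms(1)]
      hyp2F1_conv_reg[OF one_minus_notin_nonpos_Ints(1)[OF assms(2)] w, symmetric]
    by (simp only: mult_ac)
  have p2: "ferrers_p \<nu> (-\<mu>) x = rGamma (\<mu> + 1) * ((1 - x) / (1 + x)) powr (\<mu> / 2) *
       hyp2F1 (- \<nu>) (\<nu> + 1) (1 + \<mu>) ((1 - x) / 2)"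
    using hyp2F1_conv_reg[OF one_minus_notin_nonpos_Ints(2)[OF assms(2)] w, of "-\<nu>" "\<nu> + 1", symmetric]
    unfolding ferrers_p_def pow2 by (simp add: mult_ac add.commute)
  show ?thesis
    unfolding ferrers_Q_conv_combination[OF assms(2) \<nu> assms(1)] ferrers_combination_def p1 p2
    by (simp only: mult_ac)
qed

end
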